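(* Let $\mathbb{H}_1,\ldots,\mathbb{H}_n$ be complex Hilbert spaces and, for $i=1,\ldots,n$, let $A_i\in\mathbb{B}(\mathbb{H}_i,\mathbb{H}_1)$ and $B_i\in\mathbb{B}(\mathbb{H}_1,\mathbb{H}_i)$. Then $$r\left(\sum_{i=1}^n A_iB_i\right)\le\omega\left([\lambda_{ij}]_{i,j=1}^n\right),$$ where $[\lambda_{ij}]_{i,j=1}^n$ is the $n\times n$ scalar matrix with entries $$\lambda_{ij}=\begin{cases}\omega(B_iA_i) & \text{if } i=j,\\ \sqrt{\omega\left(|B_iA_j|+\mathrm{i}|A_i^*B_j^*|\right)\,\omega\left(|A_j^*B_i^*|+\mathrm{i}|B_jA_i|\right)+\tfrac12\left\||B_iA_j|^2+|A_i^*B_j^*|^2\right\|+\omega(B_jA_iB_iA_j)} & \text{if } i<j,\\ 0 & \text{if } i>j.\end{cases}$$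
   Context: $\mathbb{B}(\mathbb{H}_1,\mathbb{H}_2)$ is the set of bounded linear operators from the complex Hilbert space $\mathbb{H}_1$ to the complex Hilbert space $\mathbb{H}_2$, and $\mathbb{B}(\mathbb{H})=\mathbb{B}(\mathbb{H},\mathbb{H})$. $\|\cdot\|$ is the usual operator norm. For a bounded operator $T$ between Hilbert spaces, $T^*$ is its adjoint and $|T|=(T^*T)^{1/2}$. For $T\in\mathbb{B}(\mathbb{H})$, the numerical radius is $\omega(T)=\sup\{|\langle Tx,x\rangle|:x\in\mathbb{H},\|x\|=1\}$ and the spectral radius is $r(T)=\sup\{|\lambda|:\lambda \text{ is in the spectrum of } T\}$. For an $n\times n$ scalar matrix the numerical radius is taken as an operator on $\mathbb{C}^n$ with the standard inner product. $\mathrm{i}$ (roman) is the imaginary unit, while $i,j$ (italic) are indices. *)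

theory Defs
  imports
    "HOL-Analysis.Analysis"
    "HOL-Algebra.Algebraic_Closure_Type"
    "Jordan_Normal_Form.Matrix"
begin

text \<open>
  The spaces carry explicit carriers, so that a family \<open>H 1, \<dots>, H n\<close> of different Hilbert
  spaces, each with its own operations, can be formed inside one statement. A space is a module
  record over the field of complex numbers (the fields \<open>mult\<close> and \<open>one\<close> of that record play no
  role) with an inner product, linear in the first argument.
\<close>

record 'a cinner_space = "(complex, 'a) module" +
  cinner :: "'a \<Rightarrow> 'a \<Rightarrow> complex"

definition cnorm :: "('a, 'm) cinner_space_scheme \<Rightarrow> 'a \<Rightarrow> real" where
  "cnorm H x = sqrt (Re (cinner H x x))"

locale chilbert = module "ring_of_type_algebra :: complex ring" H
  for H :: "('a, 'm) cinner_space_scheme" (structure) +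
  assumes cinner_add_left:
      "\<lbrakk>x \<in> carrier H; y \<in> carrier H; z \<in> carrier H\<rbrakk> \<Longrightarrow>
        cinner H (x \<oplus>\<^bsub>H\<^esub> y) z = cinner H x z + cinner H y z"
    and cinner_smult_left:
      "\<lbrakk>x \<in> carrier H; y \<in> carrier H\<rbrakk> \<Longrightarrow> cinner H (a \<odot>\<^bsub>H\<^esub> x) y = a * cinner H x y"
    and cinner_commute:
      "\<lbrakk>x \<in> carrier H; y \<in> carrier H\<rbrakk> \<Longrightarrow> cinner H x y = cnj (cinner H y x)"
    and cinner_nonneg: "x \<in> carrier H \<Longrightarrow> 0 \<le> Re (cinner H x x)"
    and cinner_definite: "\<lbrakk>x \<in> carrier H; cinner H x x = 0\<rbrakk> \<Longrightarrow> x = \<zero>\<^bsub>H\<^esub>"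
    and complete:
      "\<lbrakk>range s \<subseteq> carrier H;
        \<And>e. 0 < e \<Longrightarrow> \<exists>N. \<forall>m\<ge>N. \<forall>k\<ge>N. cnorm H (s m \<ominus>\<^bsub>H\<^esub> s k) < e\<rbrakk> \<Longrightarrow>
        \<exists>x\<in>carrier H. (\<lambda>k. cnorm H (s k \<ominus>\<^bsub>H\<^esub> x)) \<longlonglongrightarrow> 0"

text \<open>
  Operators from \<open>H\<close> to \<open>K\<close> are functions of which only the values on \<open>carrier H\<close> matter; two of
  them are the same operator if they agree there. No condition is imposed outside the carrier.
\<close>

definition bounded_op ::
  "('a, 'm) cinner_space_scheme \<Rightarrow> ('b, 'k) cinner_space_scheme \<Rightarrow> ('a \<Rightarrow> 'b) set" where
  "bounded_op H K = {T \<in> carrier H \<rightarrow> carrier K.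
     (\<forall>x\<in>carrier H. \<forall>y\<in>carrier H. T (x \<oplus>\<^bsub>H\<^esub> y) = T x \<oplus>\<^bsub>K\<^esub> T y) \<and>
     (\<forall>a. \<forall>x\<in>carrier H. T (a \<odot>\<^bsub>H\<^esub> x) = a \<odot>\<^bsub>K\<^esub> T x) \<and>
     (\<exists>c. \<forall>x\<in>carrier H. cnorm K (T x) \<le> c * cnorm H x)}"

definition op_norm ::
  "('a, 'm) cinner_space_scheme \<Rightarrow> ('b, 'k) cinner_space_scheme \<Rightarrow> ('a \<Rightarrow> 'b) \<Rightarrow> real" where
  "op_norm H K T = Sup {cnorm K (T x) | x. x \<in> carrier H \<and> cnorm H x \<le> 1}"

text \<open>
  The conditions \<open>S \<in> extensional \<dots>\<close> below only select one representative of the operator,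
  which makes it unique as a function.
\<close>

definition adj ::
  "('a, 'm) cinner_space_scheme \<Rightarrow> ('b, 'k) cinner_space_scheme \<Rightarrow> ('a \<Rightarrow> 'b) \<Rightarrow> 'b \<Rightarrow> 'a" where
  "adj H K T = (THE S. S \<in> bounded_op K H \<and> S \<in> extensional (carrier K) \<and>
     (\<forall>x\<in>carrier H. \<forall>y\<in>carrier K. cinner K (T x) y = cinner H x (S y)))"

definition positive_op :: "('a, 'm) cinner_space_scheme \<Rightarrow> ('a \<Rightarrow> 'a) \<Rightarrow> bool" where
  "positive_op H T \<longleftrightarrow> T \<in> bounded_op H H \<and>
     (\<forall>x\<in>carrier H. cinner H (T x) x \<in> \<real> \<and> 0 \<le> Re (cinner H (T x) x))"

definition op_sqrt :: "('a, 'm) cinner_space_scheme \<Rightarrow> ('a \<Rightarrow> 'a) \<Rightarrow> 'a \<Rightarrow> 'a" where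
  "op_sqrt H T = (THE S. positive_op H S \<and> S \<in> extensional (carrier H) \<and>
     (\<forall>x\<in>carrier H. S (S x) = T x))"

definition op_abs ::
  "('a, 'm) cinner_space_scheme \<Rightarrow> ('b, 'k) cinner_space_scheme \<Rightarrow> ('a \<Rightarrow> 'b) \<Rightarrow> 'a \<Rightarrow> 'a" where
  "op_abs H K T = op_sqrt H (adj H K T \<circ> T)"

definition op_add ::
  "('a, 'm) cinner_space_scheme \<Rightarrow> ('a \<Rightarrow> 'a) \<Rightarrow> ('a \<Rightarrow> 'a) \<Rightarrow> 'a \<Rightarrow> 'a" where
  "op_add H S T = (\<lambda>x. S x \<oplus>\<^bsub>H\<^esub> T x)"

definition op_scale ::
  "('a, 'm) cinner_space_scheme \<Rightarrow> complex \<Rightarrow> ('a \<Rightarrow> 'a) \<Rightarrow> 'a \<Rightarrow> 'a" where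
  "op_scale H a T = (\<lambda>x. a \<odot>\<^bsub>H\<^esub> T x)"

text \<open>
  Both suprema are taken in \<open>[0, \<infinity>)\<close>: inserting \<open>0\<close> changes nothing unless the space is zero, in
  which case the set of moduli is empty and the value is \<open>0\<close>.
\<close>

definition numerical_radius :: "('a, 'm) cinner_space_scheme \<Rightarrow> ('a \<Rightarrow> 'a) \<Rightarrow> real" where
  "numerical_radius H T =
     Sup (insert 0 {cmod (cinner H (T x) x) | x. x \<in> carrier H \<and> cnorm H x = 1})"

definition op_spectrum :: "('a, 'm) cinner_space_scheme \<Rightarrow> ('a \<Rightarrow> 'a) \<Rightarrow> complex set" where
  "op_spectrum H T = {l. \<not> (\<exists>S\<in>bounded_op H H. \<forall>x\<in>carrier H.
     S (T x \<ominus>\<^bsub>H\<^esub> l \<odot>\<^bsub>H\<^esub> x) = x \<and> T (S x) \<ominus>\<^bsub>H\<^esub> l \<odot>\<^bsub>H\<^esub> S x = x)}"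

definition op_spectral_radius :: "('a, 'm) cinner_space_scheme \<Rightarrow> ('a \<Rightarrow> 'a) \<Rightarrow> real" where
  "op_spectral_radius H T = Sup (insert 0 {cmod l | l. l \<in> op_spectrum H T})"

definition std_space :: "nat \<Rightarrow> complex vec cinner_space" where
  "std_space n = module.extend (module_vec TYPE(complex) n) \<lparr>cinner = (\<lambda>x y. x \<bullet>c y)\<rparr>"

definition mat_numerical_radius :: "nat \<Rightarrow> complex mat \<Rightarrow> real" where
  "mat_numerical_radius n M = numerical_radius (std_space n) (\<lambda>x. M *\<^sub>v x)"

definition lam ::
  "(nat \<Rightarrow> 'a cinner_space) \<Rightarrow> (nat \<Rightarrow> 'a \<Rightarrow> 'a) \<Rightarrow> (nat \<Rightarrow> 'a \<Rightarrow> 'a) \<Rightarrow> nat \<Rightarrow> nat \<Rightarrow> real" where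
  "lam H A B i j =
    (let As = (\<lambda>k. adj (H k) (H 1) (A k)); Bs = (\<lambda>k. adj (H 1) (H k) (B k));
         P = op_abs (H j) (H i) (B i \<circ> A j);
         Q = op_abs (H j) (H i) (As i \<circ> Bs j);
         R = op_abs (H i) (H j) (As j \<circ> Bs i);
         S = op_abs (H i) (H j) (B j \<circ> A i)
     in if i = j then numerical_radius (H i) (B i \<circ> A i)
        else if i < j then
          sqrt (numerical_radius (H j) (op_add (H j) P (op_scale (H j) \<i> Q)) *
                numerical_radius (H i) (op_add (H i) R (op_scale (H i) \<i> S)) +
                1 / 2 * op_norm (H j) (H j) (op_add (H j) (P \<circ> P) (Q \<circ> Q)) +
                numerical_radius (H j) (B j \<circ> A i \<circ> B i \<circ> A j))
        else 0)"

end

(*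
  The nonzero spectrum of AB = sum A_i B_i is that of the block operator [B_i A_j] on the direct
  sum of the H_i, so it suffices to bound the numerical range of the latter. Pairing the entries
  (i, j) and (j, i) and writing V = B_i A_j, W = B_j A_i, one has to estimate
  |<V x, y>| + |<W y, x>|. Its square consists of |<V x, y>|^2 + |<W y, x>|^2, which the mixed
  Schwarz inequality |<V x, y>|^2 <= <|V| x, x> <|V^*| y, y> bounds by the two numerical radii of
  |V| + i|W^*| and |V^*| + i|W|, and of 2 |<V x, y> <y, W^* x>|, which Buzano's inequality bounds by
  (|V x| |W^* x| + |<W V x, x>|) |y|^2. The result is lambda_ij |x| |y|, and the block operator is
  dominated by the scalar matrix [lambda_ij] applied to the vector of norms.
*)
theory Submission
  imports Defs
begin

section \<open>Complex Hilbert spaces on a carrier\<close>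

text \<open>The direct sum is not formed, and the equality of the nonzero spectra is not invoked. A
  vector of the direct sum is a family \<open>z\<close> with \<open>z i\<close> in
  \<open>H i\<close>, and a number \<open>l\<close> beyond the bound is shown to be regular
  directly: \<open>AB - l\<close> is bounded below and has dense range, because the numerical range
  of the block operator stays away from \<open>l\<close>. A variational argument turns these two
  facts into a bounded inverse; the same argument yields the Riesz representation and hence
  adjoints.

  The obstacle is \<open>|T|\<close>. Adjoints, roots and absolute values are definite descriptions,
  about which nothing is known before existence and uniqueness are proved; the root is therefore
  built as the limit of an elementary iteration. The mixed Schwarz inequality also needs a relation
  between roots on two different spaces: if \<open>V P = P' V\<close>, then \<open>V\<close>
  intertwines the roots of \<open>P\<close> and \<open>P'\<close> as well. For \<open>V = T\<close>
  this gives \<open>T |T| = |adj T| T\<close>, which does the work of the polar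
  decomposition.\<close>

context chilbert
begin

lemma smult_mem [simp]: "x \<in> carrier H \<Longrightarrow> a \<odot> x \<in> carrier H"
  by (rule smult_closed) (simp add: ring_of_type_algebra_def)

lemma cinner_add_right:
  "\<lbrakk>x \<in> carrier H; y \<in> carrier H; z \<in> carrier H\<rbrakk> \<Longrightarrow> cinner H z (x \<oplus> y) = cinner H z x + cinner H z y"
  by (metis cinner_add_left cinner_commute complex_cnj_add M.add.m_closed)

lemma cinner_smult_right:
  "\<lbrakk>x \<in> carrier H; y \<in> carrier H\<rbrakk> \<Longrightarrow> cinner H x (a \<odot> y) = cnj a * cinner H x y"
  by (metis cinner_smult_left cinner_commute complex_cnj_mult smult_mem)

lemma cinner_zero_left: "y \<in> carrier H \<Longrightarrow> cinner H \<zero>\<^bsub>H\<^esub> y = 0"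
  using cinner_add_left[of "\<zero>\<^bsub>H\<^esub>" "\<zero>\<^bsub>H\<^esub>" y] by simp

lemma cinner_zero_right: "y \<in> carrier H \<Longrightarrow> cinner H y \<zero>\<^bsub>H\<^esub> = 0"
  using cinner_add_right[of "\<zero>\<^bsub>H\<^esub>" "\<zero>\<^bsub>H\<^esub>" y] by simp

lemma cinner_uminus_left:
  "\<lbrakk>x \<in> carrier H; y \<in> carrier H\<rbrakk> \<Longrightarrow> cinner H (\<ominus>\<^bsub>H\<^esub> x) y = - cinner H x y"
  using cinner_add_left[of x "\<ominus>\<^bsub>H\<^esub> x" y]
  by (simp add: M.r_neg cinner_zero_left eq_neg_iff_add_eq_0 add.commute)

lemma cinner_uminus_right:
  "\<lbrakk>x \<in> carrier H; y \<in> carrier H\<rbrakk> \<Longrightarrow> cinner H y (\<ominus>\<^bsub>H\<^esub> x) = - cinner H y x"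
  by (metis cinner_commute cinner_uminus_left complex_cnj_minus M.a_inv_closed)

lemma cinner_diff_left:
  "\<lbrakk>x \<in> carrier H; y \<in> carrier H; z \<in> carrier H\<rbrakk> \<Longrightarrow> cinner H (x \<ominus>\<^bsub>H\<^esub> y) z = cinner H x z - cinner H y z"
  by (simp add: a_minus_def cinner_add_left cinner_uminus_left)

lemma cinner_diff_right:
  "\<lbrakk>x \<in> carrier H; y \<in> carrier H; z \<in> carrier H\<rbrakk> \<Longrightarrow> cinner H z (x \<ominus>\<^bsub>H\<^esub> y) = cinner H z x - cinner H z y"
  by (simp add: a_minus_def cinner_add_right cinner_uminus_right)

lemmas cinner_simps = cinner_add_left cinner_add_right cinner_smult_left cinner_smult_right
  cinner_zero_left cinner_zero_right cinner_uminus_left cinner_uminus_right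
  cinner_diff_left cinner_diff_right

lemma cinner_finsum_left:
  assumes "finite I" "\<And>i. i \<in> I \<Longrightarrow> f i \<in> carrier H" "y \<in> carrier H"
  shows "cinner H (\<Oplus>\<^bsub>H\<^esub>i\<in>I. f i) y = (\<Sum>i\<in>I. cinner H (f i) y)"
  using assms
proof (induction I rule: finite_induct)
  case (insert i I)
  have "f \<in> I \<rightarrow> carrier H" "f i \<in> carrier H" using insert.prems by auto
  then show ?case
    using insert by (simp add: cinner_add_left)
qed (simp add: cinner_zero_left)

lemma cinner_self: "x \<in> carrier H \<Longrightarrow> cinner H x x = of_real ((cnorm H x)\<^sup>2)"
  using cinner_commute[of x x] cinner_nonneg[of x] by (simp add: cnorm_def complex_eq_iff)

lemma cnorm_nonneg [simp]: "x \<in> carrier H \<Longrightarrow> 0 \<le> cnorm H x"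
  by (simp add: cnorm_def cinner_nonneg)

lemma cnorm_sq: "x \<in> carrier H \<Longrightarrow> (cnorm H x)\<^sup>2 = Re (cinner H x x)"
  by (simp add: cnorm_def cinner_nonneg)

lemma cnorm_eq_0:
  assumes "x \<in> carrier H"
  shows "cnorm H x = 0 \<longleftrightarrow> x = \<zero>\<^bsub>H\<^esub>"
proof
  assume "cnorm H x = 0"
  then have "cinner H x x = 0" using cinner_self[OF assms] by simp
  then show "x = \<zero>\<^bsub>H\<^esub>" using cinner_definite assms by blast
next
  assume "x = \<zero>\<^bsub>H\<^esub>"
  then show "cnorm H x = 0" by (simp only: cnorm_def cinner_zero_left[OF M.zero_closed]) simp
qed

lemma cnorm_zero [simp]: "cnorm H \<zero>\<^bsub>H\<^esub> = 0"
  by (simp add: cnorm_eq_0)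

lemma cnorm_smult: "x \<in> carrier H \<Longrightarrow> cnorm H (a \<odot> x) = cmod a * cnorm H x"
proof -
  assume x: "x \<in> carrier H"
  have "cinner H (a \<odot> x) (a \<odot> x) = of_real ((cmod a)\<^sup>2) * cinner H x x"
    using x by (simp add: cinner_simps complex_norm_square del: of_real_power)
  then have "Re (cinner H (a \<odot> x) (a \<odot> x)) = (cmod a)\<^sup>2 * Re (cinner H x x)"
    by (simp del: of_real_power)
  then have "(cnorm H (a \<odot> x))\<^sup>2 = (cmod a * cnorm H x)\<^sup>2"
    using x by (simp add: cnorm_sq power_mult_distrib)
  then show ?thesis
    using x by (simp add: power2_eq_iff_nonneg)
qed

text \<open>Testing against all vectors reduces identities in the module to identities between
  complex numbers; most vector equations below are proved this way.\<close>

lemma vec_eqI: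
  assumes "x \<in> carrier H" "y \<in> carrier H" "\<And>z. z \<in> carrier H \<Longrightarrow> cinner H x z = cinner H y z"
  shows "x = y"
proof -
  have "cinner H (x \<ominus>\<^bsub>H\<^esub> y) (x \<ominus>\<^bsub>H\<^esub> y) = 0"
    using assms by (simp add: cinner_diff_left)
  then have "x \<ominus>\<^bsub>H\<^esub> y = \<zero>\<^bsub>H\<^esub>"
    using assms by (simp add: cinner_definite)
  then have "y \<oplus> (x \<ominus> y) = y"
    using assms by simp
  moreover have "y \<oplus> (x \<ominus> y) = x"
    using assms(1,2) by (simp add: a_minus_def M.a_lcomm M.r_neg)
  ultimately show ?thesis
    by simp
qed

end

text \<open>Put \<open>a = - t * cnj w\<close> and minimise over \<open>t\<close>.\<close>

lemma norm_sq_le_mult_if_quadratic_nonneg: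
  fixes p q :: real and w :: complex
  assumes "0 \<le> q" and nonneg: "\<And>a. 0 \<le> p + 2 * Re (a * w) + (cmod a)\<^sup>2 * q"
  shows "(cmod w)\<^sup>2 \<le> p * q"
proof -
  have *: "0 \<le> p - 2 * t * (cmod w)\<^sup>2 + t\<^sup>2 * (cmod w)\<^sup>2 * q" for t :: real
  proof -
    have "Re (- of_real t * cnj w * w) = - t * (cmod w)\<^sup>2"
      by (simp add: cmod_power2) (simp add: power2_eq_square algebra_simps)
    then show ?thesis
      using nonneg[of "- of_real t * cnj w"] by (simp add: norm_mult power_mult_distrib)
  qed
  show ?thesis
  proof (cases "q = 0")
    case True
    have "w = 0"
    proof (rule ccontr)
      assume "w \<noteq> 0"
      \<comment> \<open>For \<open>q = 0\<close> the expression is affine in \<open>t\<close>; this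
        \<open>t\<close> makes it equal to \<open>-1\<close>.\<close>
      then show False
        using *[of "(p + 1) / (2 * (cmod w)\<^sup>2)"] True by simp
    qed
    then show ?thesis using True by simp
  next
    case False
    then have "0 \<le> p - (cmod w)\<^sup>2 / q"
      using *[of "1 / q"] by (simp add: power2_eq_square)
    then show ?thesis
      using False \<open>0 \<le> q\<close> by (simp add: field_simps)
  qed
qed

section \<open>Bounded operators\<close>

lemma bounded_opI:
  assumes "\<And>x. x \<in> carrier H \<Longrightarrow> T x \<in> carrier K"
    and "\<And>x y. \<lbrakk>x \<in> carrier H; y \<in> carrier H\<rbrakk> \<Longrightarrow> T (x \<oplus>\<^bsub>H\<^esub> y) = T x \<oplus>\<^bsub>K\<^esub> T y"
    and "\<And>a x. x \<in> carrier H \<Longrightarrow> T (a \<odot>\<^bsub>H\<^esub> x) = a \<odot>\<^bsub>K\<^esub> T x"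
    and "\<And>x. x \<in> carrier H \<Longrightarrow> cnorm K (T x) \<le> c * cnorm H x"
  shows "T \<in> bounded_op H K"
  using assms unfolding bounded_op_def by blast

lemma bounded_op_mem: "\<lbrakk>T \<in> bounded_op H K; x \<in> carrier H\<rbrakk> \<Longrightarrow> T x \<in> carrier K"
  unfolding bounded_op_def by blast

lemma bounded_op_add:
  "\<lbrakk>T \<in> bounded_op H K; x \<in> carrier H; y \<in> carrier H\<rbrakk> \<Longrightarrow> T (x \<oplus>\<^bsub>H\<^esub> y) = T x \<oplus>\<^bsub>K\<^esub> T y"
  unfolding bounded_op_def by blast

lemma bounded_op_smult:
  "\<lbrakk>T \<in> bounded_op H K; x \<in> carrier H\<rbrakk> \<Longrightarrow> T (a \<odot>\<^bsub>H\<^esub> x) = a \<odot>\<^bsub>K\<^esub> T x"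
  unfolding bounded_op_def by blast

section \<open>Cauchy-Schwarz, the triangle inequality and limits\<close>

context chilbert
begin

lemma cnorm_sq_add:
  assumes "x \<in> carrier H" "y \<in> carrier H"
  shows "(cnorm H (x \<oplus> y))\<^sup>2 = (cnorm H x)\<^sup>2 + 2 * Re (cinner H x y) + (cnorm H y)\<^sup>2"
  using assms cinner_commute[of y x] by (simp add: cnorm_sq cinner_simps)

lemma cnorm_sq_diff:
  assumes "x \<in> carrier H" "y \<in> carrier H"
  shows "(cnorm H (x \<ominus> y))\<^sup>2 = (cnorm H x)\<^sup>2 - 2 * Re (cinner H x y) + (cnorm H y)\<^sup>2"
  using assms cinner_commute[of y x] by (simp add: cnorm_sq cinner_simps)

lemma Cauchy_Schwarz:
  assumes "x \<in> carrier H" "y \<in> carrier H"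
  shows "cmod (cinner H x y) \<le> cnorm H x * cnorm H y"
proof -
  have "0 \<le> (cnorm H x)\<^sup>2 + 2 * Re (a * cinner H x y) + (cmod a)\<^sup>2 * (cnorm H y)\<^sup>2" for a
  proof -
    have "0 \<le> (cnorm H (x \<oplus> cnj a \<odot> y))\<^sup>2" by simp
    then show ?thesis
      using assms by (simp add: cnorm_sq_add cnorm_smult cinner_simps power_mult_distrib)
  qed
  then have "(cmod (cinner H x y))\<^sup>2 \<le> (cnorm H x)\<^sup>2 * (cnorm H y)\<^sup>2"
    by (intro norm_sq_le_mult_if_quadratic_nonneg) auto
  then show ?thesis
    using assms by (metis power_mult_distrib power2_le_imp_le cnorm_nonneg mult_nonneg_nonneg)
qed

lemma cnorm_triangle:
  assumes "x \<in> carrier H" "y \<in> carrier H"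
  shows "cnorm H (x \<oplus> y) \<le> cnorm H x + cnorm H y"
proof (rule power2_le_imp_le)
  have "Re (cinner H x y) \<le> cnorm H x * cnorm H y"
    using Cauchy_Schwarz[OF assms] complex_Re_le_cmod order_trans by blast
  then show "(cnorm H (x \<oplus> y))\<^sup>2 \<le> (cnorm H x + cnorm H y)\<^sup>2"
    using assms by (simp add: cnorm_sq_add power2_sum)
qed (use assms in simp)

lemma cnorm_uminus: "x \<in> carrier H \<Longrightarrow> cnorm H (\<ominus> x) = cnorm H x"
  by (simp add: cnorm_def cinner_simps)

lemma cnorm_diff_triangle:
  "\<lbrakk>x \<in> carrier H; y \<in> carrier H\<rbrakk> \<Longrightarrow> cnorm H (x \<ominus> y) \<le> cnorm H x + cnorm H y"
  using cnorm_triangle[of x "\<ominus> y"] by (simp add: a_minus_def cnorm_uminus)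

lemma cnorm_finsum:
  assumes "finite I" "\<And>i. i \<in> I \<Longrightarrow> f i \<in> carrier H"
  shows "cnorm H (\<Oplus>i\<in>I. f i) \<le> (\<Sum>i\<in>I. cnorm H (f i))"
  using assms
proof (induction I rule: finite_induct)
  case (insert i I)
  have f: "f \<in> I \<rightarrow> carrier H" "f i \<in> carrier H" using insert.prems by auto
  then have "cnorm H (f i \<oplus> (\<Oplus>i\<in>I. f i)) \<le> cnorm H (f i) + cnorm H (\<Oplus>i\<in>I. f i)"
    by (intro cnorm_triangle) auto
  then show ?case
    using insert f by simp
qed simp

lemma tendsto_cinner:
  assumes lim: "(\<lambda>k. cnorm H (s k \<ominus> x)) \<longlonglongrightarrow> 0"
    and mem: "\<And>k. s k \<in> carrier H" "x \<in> carrier H" "y \<in> carrier H"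
  shows "(\<lambda>k. cinner H (s k) y) \<longlonglongrightarrow> cinner H x y"
proof (rule Lim_null_comparison[THEN LIM_zero_cancel])
  show "\<forall>\<^sub>F k in sequentially. norm (cinner H (s k) y - cinner H x y) \<le> cnorm H (s k \<ominus> x) * cnorm H y"
    using mem Cauchy_Schwarz[of "s _ \<ominus> x" y] by (simp add: cinner_diff_left)
  show "(\<lambda>k. cnorm H (s k \<ominus> x) * cnorm H y) \<longlonglongrightarrow> 0"
    using tendsto_mult_right[OF lim, of "cnorm H y"] by simp
qed

lemma tendsto_cnorm:
  assumes lim: "(\<lambda>k. cnorm H (s k \<ominus> x)) \<longlonglongrightarrow> 0"
    and mem: "\<And>k. s k \<in> carrier H" "x \<in> carrier H"
  shows "(\<lambda>k. cnorm H (s k)) \<longlonglongrightarrow> cnorm H x"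
proof (rule Lim_null_comparison[THEN LIM_zero_cancel])
  have "\<bar>cnorm H (s k) - cnorm H x\<bar> \<le> cnorm H (s k \<ominus> x)" for k
  proof -
    have 1: "s k = (s k \<ominus> x) \<oplus> x" "x = s k \<ominus> (s k \<ominus> x)"
      using mem by (auto intro!: vec_eqI simp: cinner_simps)
    have "cnorm H (s k) \<le> cnorm H (s k \<ominus> x) + cnorm H x"
      by (subst 1(1), rule cnorm_triangle) (use mem in auto)
    moreover have "cnorm H x \<le> cnorm H (s k) + cnorm H (s k \<ominus> x)"
      by (subst 1(2), rule cnorm_diff_triangle) (use mem in auto)
    ultimately show ?thesis by simp
  qed
  then show "\<forall>\<^sub>F k in sequentially. norm (cnorm H (s k) - cnorm H x) \<le> cnorm H (s k \<ominus> x)"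
    by simp
qed (rule lim)

end

text \<open>A constant from the definition may be negative when the space is zero; multiplying
  bounds needs a nonnegative one.\<close>

lemma bounded_op_bound:
  assumes "T \<in> bounded_op H K" "chilbert H"
  obtains c where "0 \<le> c" "\<And>x. x \<in> carrier H \<Longrightarrow> cnorm K (T x) \<le> c * cnorm H x"
proof -
  interpret chilbert H by fact
  obtain c where c: "\<And>x. x \<in> carrier H \<Longrightarrow> cnorm K (T x) \<le> c * cnorm H x"
    using assms(1) unfolding bounded_op_def by blast
  have "cnorm K (T x) \<le> max c 0 * cnorm H x" if "x \<in> carrier H" for x
    using c[OF that] mult_right_mono[of c "max c 0" "cnorm H x"] that by auto
  then show thesis
    using that[of "max c 0"] by simp
qed

lemma bounded_op_diff:
  assumes "T \<in> bounded_op H K" "chilbert H" "chilbert K" "x \<in> carrier H" "y \<in> carrier H"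
  shows "T (x \<ominus>\<^bsub>H\<^esub> y) = T x \<ominus>\<^bsub>K\<^esub> T y"
proof -
  interpret H: chilbert H by fact
  interpret K: chilbert K by fact
  have *: "x \<ominus>\<^bsub>H\<^esub> y = x \<oplus>\<^bsub>H\<^esub> (- 1) \<odot>\<^bsub>H\<^esub> y"
    using assms(4,5) by (intro H.vec_eqI) (auto simp: H.cinner_simps)
  show ?thesis
    unfolding *
    using assms by (intro K.vec_eqI)
      (auto simp: bounded_op_add bounded_op_smult K.cinner_simps bounded_op_mem)
qed

lemma bounded_op_comp:
  assumes "T \<in> bounded_op H K" "S \<in> bounded_op K L" "chilbert H" "chilbert K"
  shows "S \<circ> T \<in> bounded_op H L"
proof -
  obtain c where c: "\<And>x. x \<in> carrier H \<Longrightarrow> cnorm K (T x) \<le> c * cnorm H x"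
    using bounded_op_bound assms by metis
  obtain d where d: "0 \<le> d" "\<And>x. x \<in> carrier K \<Longrightarrow> cnorm L (S x) \<le> d * cnorm K x"
    using bounded_op_bound assms by metis
  have "cnorm L (S (T x)) \<le> d * c * cnorm H x" if "x \<in> carrier H" for x
    using d(2)[of "T x"] mult_left_mono[OF c[OF that] d(1)] that assms(1)
    by (simp add: bounded_op_mem mult.assoc)
  then show ?thesis
    using assms by (intro bounded_opI[where c = "d * c"])
      (auto simp: bounded_op_mem bounded_op_add bounded_op_smult)
qed

lemma (in chilbert) bounded_op_id: "(\<lambda>x. x) \<in> bounded_op H H"
  by (rule bounded_opI[where c = 1]) auto

lemma bounded_op_op_add:
  assumes "T \<in> bounded_op H K" "S \<in> bounded_op H K" "chilbert H" "chilbert K"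
  shows "(\<lambda>x. T x \<oplus>\<^bsub>K\<^esub> S x) \<in> bounded_op H K"
proof -
  interpret H: chilbert H by fact
  interpret K: chilbert K by fact
  obtain c where c: "\<And>x. x \<in> carrier H \<Longrightarrow> cnorm K (T x) \<le> c * cnorm H x"
    using bounded_op_bound assms by metis
  obtain d where d: "\<And>x. x \<in> carrier H \<Longrightarrow> cnorm K (S x) \<le> d * cnorm H x"
    using bounded_op_bound assms by metis
  show ?thesis
  proof (rule bounded_opI[where c = "c + d"])
    fix x assume x: "x \<in> carrier H"
    have "cnorm K (T x \<oplus>\<^bsub>K\<^esub> S x) \<le> cnorm K (T x) + cnorm K (S x)"
      using x assms by (intro K.cnorm_triangle) (auto simp: bounded_op_mem)
    then show "cnorm K (T x \<oplus>\<^bsub>K\<^esub> S x) \<le> (c + d) * cnorm H x"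
      using c[OF x] d[OF x] by (simp add: distrib_right)
  qed (use assms in \<open>auto intro!: K.vec_eqI simp: bounded_op_mem bounded_op_add bounded_op_smult
      K.cinner_simps distrib_left\<close>)
qed

lemma bounded_op_op_scale:
  assumes "T \<in> bounded_op H K" "chilbert H" "chilbert K"
  shows "(\<lambda>x. a \<odot>\<^bsub>K\<^esub> T x) \<in> bounded_op H K"
proof -
  interpret K: chilbert K by fact
  obtain c where c: "\<And>x. x \<in> carrier H \<Longrightarrow> cnorm K (T x) \<le> c * cnorm H x"
    using bounded_op_bound assms by metis
  show ?thesis
  proof (rule bounded_opI[where c = "cmod a * c"])
    fix x assume x: "x \<in> carrier H"
    show "cnorm K (a \<odot>\<^bsub>K\<^esub> T x) \<le> cmod a * c * cnorm H x"
      using c[OF x] x assms mult_left_mono[OF c[OF x], of "cmod a"]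
      by (simp add: K.cnorm_smult bounded_op_mem mult.assoc)
  qed (use assms in \<open>auto intro!: K.vec_eqI simp: bounded_op_mem bounded_op_add bounded_op_smult
      K.cinner_simps distrib_left\<close>)
qed

section \<open>Riesz representation and adjoints\<close>

lemma tendsto_bounded_op:
  assumes "T \<in> bounded_op H K" "chilbert H" "chilbert K"
    and lim: "(\<lambda>k. cnorm H (s k \<ominus>\<^bsub>H\<^esub> x)) \<longlonglongrightarrow> 0"
    and mem: "\<And>k. s k \<in> carrier H" "x \<in> carrier H"
  shows "(\<lambda>k. cnorm K (T (s k) \<ominus>\<^bsub>K\<^esub> T x)) \<longlonglongrightarrow> 0"
proof -
  interpret H: chilbert H by fact
  interpret K: chilbert K by fact
  obtain c where c: "\<And>x. x \<in> carrier H \<Longrightarrow> cnorm K (T x) \<le> c * cnorm H x"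
    using bounded_op_bound assms(1,2) by metis
  have "norm (cnorm K (T (s k) \<ominus>\<^bsub>K\<^esub> T x)) \<le> c * cnorm H (s k \<ominus>\<^bsub>H\<^esub> x)" for k
    using c[of "s k \<ominus>\<^bsub>H\<^esub> x"] mem assms by (simp add: bounded_op_diff bounded_op_mem)
  moreover have "(\<lambda>k. c * cnorm H (s k \<ominus>\<^bsub>H\<^esub> x)) \<longlonglongrightarrow> 0"
    using tendsto_mult_left[OF lim, of c] by simp
  ultimately show ?thesis
    by (rule Lim_null_comparison[OF always_eventually, OF allI])
qed

text \<open>The polynomial has a minimum at \<open>t = 0\<close>, so its derivative
  \<open>2 * r\<close> vanishes there. This is the first-order condition at the minimiser in
  \<open>ex_representer\<close>.\<close>

lemma zero_if_quadratic_nonneg: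
  fixes r q :: real
  assumes "0 \<le> q" "\<And>t. 0 \<le> 2 * t * r + t\<^sup>2 * q"
  shows "r = 0"
proof -
  have "r\<^sup>2 \<le> 0"
  proof (cases "q = 0")
    case True
    then show ?thesis using assms(2)[of "- r"] by (simp add: power2_eq_square)
  next
    case False
    then have "0 \<le> - (r\<^sup>2 / q)"
      using assms(2)[of "- r / q"] by (simp add: power2_eq_square)
    then show ?thesis using False assms(1) by (simp add: divide_le_0_iff)
  qed
  then show ?thesis by simp
qed

text \<open>The representer is the minimiser of \<open>\<parallel>T h\<parallel>\<^sup>2 - 2 * Re (f h)\<close>. For \<open>T = id\<close> this is the Riesz
  representation theorem; for general \<open>T\<close> it yields surjectivity of operators bounded below.\<close>

lemma ex_representer:
  fixes f :: "'a \<Rightarrow> complex"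
  assumes T: "T \<in> bounded_op H K" and HK: "chilbert H" "chilbert K"
    and c: "0 < c" "\<And>x. x \<in> carrier H \<Longrightarrow> c * cnorm H x \<le> cnorm K (T x)"
    and f_add: "\<And>x y. \<lbrakk>x \<in> carrier H; y \<in> carrier H\<rbrakk> \<Longrightarrow> f (x \<oplus>\<^bsub>H\<^esub> y) = f x + f y"
    and f_smult: "\<And>a x. x \<in> carrier H \<Longrightarrow> f (a \<odot>\<^bsub>H\<^esub> x) = a * f x"
    and f_bound: "\<And>x. x \<in> carrier H \<Longrightarrow> cmod (f x) \<le> C * cnorm H x"
  shows "\<exists>x\<in>carrier H. \<forall>h\<in>carrier H. cinner K (T h) (T x) = f h"
proof -
  interpret H: chilbert H by fact
  interpret K: chilbert K by fact
  note [simp] = bounded_op_mem[OF T]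
  define J where "J h = (cnorm K (T h))\<^sup>2 - 2 * Re (f h)" for h
  have J_line: "J (s \<oplus>\<^bsub>H\<^esub> of_real t \<odot>\<^bsub>H\<^esub> h) =
      J s + 2 * t * Re (cinner K (T s) (T h) - f h) + t\<^sup>2 * (cnorm K (T h))\<^sup>2"
    if "s \<in> carrier H" "h \<in> carrier H" for s h t
    using that unfolding J_def
    by (simp add: bounded_op_add[OF T] bounded_op_smult[OF T] f_add f_smult K.cnorm_sq_add
        K.cnorm_smult K.cinner_simps power_mult_distrib algebra_simps)
  \<comment> \<open>Coercivity: \<open>J h\<close> is at least
    \<open>X\<^sup>2 - 2 * (C / c) * X\<close> with \<open>X = c * cnorm H h\<close>, and completing
    the square leaves \<open>- (C / c)\<^sup>2\<close>.\<close>
  have "- (C / c)\<^sup>2 \<le> J h" if h: "h \<in> carrier H" for h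
  proof -
    have "(c * cnorm H h)\<^sup>2 \<le> (cnorm K (T h))\<^sup>2"
      using c h by (intro power_mono) auto
    moreover have "Re (f h) \<le> C * cnorm H h"
      using f_bound[OF h] complex_Re_le_cmod order_trans by blast
    moreover have "2 * (C * cnorm H h) \<le> (c * cnorm H h)\<^sup>2 + (C / c)\<^sup>2"
      using sum_squares_bound[of "c * cnorm H h" "C / c"] c(1) by (simp add: mult_ac)
    ultimately show ?thesis
      unfolding J_def by linarith
  qed
  then have bdd: "bdd_below (J ` carrier H)" by (rule bdd_belowI2)
  define m where "m = Inf (J ` carrier H)"
  have m_le: "m \<le> J h" if "h \<in> carrier H" for h
    unfolding m_def using bdd that by (intro cInf_lower) auto
  have "\<exists>s. s \<in> carrier H \<and> J s < m + 1 / real (Suc k)" for k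
  proof -
    have "Inf (J ` carrier H) < m + 1 / real (Suc k)" by (simp add: m_def)
    moreover have "J ` carrier H \<noteq> {}" using H.M.zero_closed by blast
    ultimately have "\<exists>v\<in>J ` carrier H. v < m + 1 / real (Suc k)" by (intro cInf_lessD)
    then show ?thesis by blast
  qed
  then obtain s where s [simp]: "\<And>k. s k \<in> carrier H" and Js: "\<And>k. J (s k) < m + 1 / real (Suc k)"
    by metis
  \<comment> \<open>A minimising sequence is Cauchy by the parallelogram law: the linear part of
    \<open>J\<close> cancels, and \<open>J\<close> at the midpoint \<open>?p\<close> is at least
    \<open>m\<close>.\<close>
  have close: "(c * cnorm H (s i \<ominus>\<^bsub>H\<^esub> s j))\<^sup>2 \<le> 2 / real (Suc i) + 2 / real (Suc j)" for i j
  proof -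
    let ?p = "(1/2) \<odot>\<^bsub>H\<^esub> (s i \<oplus>\<^bsub>H\<^esub> s j)"
    have "(c * cnorm H (s i \<ominus>\<^bsub>H\<^esub> s j))\<^sup>2 \<le> (cnorm K (T (s i \<ominus>\<^bsub>H\<^esub> s j)))\<^sup>2"
      using c by (intro power_mono) auto
    also have "\<dots> = 2 * J (s i) + 2 * J (s j) - 4 * J ?p"
      by (simp add: J_def bounded_op_add[OF T] bounded_op_smult[OF T] f_add f_smult K.cnorm_sq_add
        bounded_op_diff[OF T HK] K.cnorm_sq_diff K.cnorm_smult power_mult_distrib algebra_simps power_divide)
    also have "\<dots> \<le> 2 / real (Suc i) + 2 / real (Suc j)"
      using m_le[of ?p] Js[of i] Js[of j] by simp
    finally show ?thesis .
  qed
  have "\<exists>x\<in>carrier H. (\<lambda>k. cnorm H (s k \<ominus>\<^bsub>H\<^esub> x)) \<longlonglongrightarrow> 0"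
  proof (rule H.complete)
    fix e :: real assume "0 < e"
    then have "0 < (c * e)\<^sup>2 / 4" using c by simp
    then obtain N where N: "inverse (real (Suc N)) < (c * e)\<^sup>2 / 4"
      using reals_Archimedean by blast
    have "cnorm H (s i \<ominus>\<^bsub>H\<^esub> s j) < e" if "N \<le> i" "N \<le> j" for i j
    proof -
      have "1 / real (Suc i) \<le> inverse (real (Suc N))" "1 / real (Suc j) \<le> inverse (real (Suc N))"
        using that by (auto simp: divide_simps)
      then have "(c * cnorm H (s i \<ominus>\<^bsub>H\<^esub> s j))\<^sup>2 < (c * e)\<^sup>2"
        using close[of i j] N by simp
      then have "c * cnorm H (s i \<ominus>\<^bsub>H\<^esub> s j) < c * e"
        by (rule power2_less_imp_less) (use c \<open>0 < e\<close> in simp)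
      then show ?thesis using c by simp
    qed
    then show "\<exists>N. \<forall>m\<ge>N. \<forall>k\<ge>N. cnorm H (s m \<ominus>\<^bsub>H\<^esub> s k) < e" by blast
  qed auto
  then obtain x where x [simp]: "x \<in> carrier H" and lim: "(\<lambda>k. cnorm H (s k \<ominus>\<^bsub>H\<^esub> x)) \<longlonglongrightarrow> 0"
    by blast
  have Re_eq: "Re (cinner K (T x) (T h)) = Re (f h)" if h [simp]: "h \<in> carrier H" for h
  proof -
    have limT: "(\<lambda>k. cinner K (T (s k)) (T h)) \<longlonglongrightarrow> cinner K (T x) (T h)"
      by (rule K.tendsto_cinner[OF tendsto_bounded_op[OF T HK lim]]) auto
    have "Re (cinner K (T x) (T h) - f h) = 0"
    proof (rule zero_if_quadratic_nonneg[where q = "(cnorm K (T h))\<^sup>2"])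
      fix t :: real
      \<comment> \<open>The variational inequality is passed to the limit along \<open>s k\<close>,
        where it holds with slack \<open>1 / Suc k\<close>. Only the inner product has to be
        continuous; \<open>J\<close> is not evaluated at \<open>x\<close>.\<close>
      have "(\<lambda>k. 2 * t * Re (cinner K (T (s k)) (T h) - f h) + t\<^sup>2 * (cnorm K (T h))\<^sup>2 + 1 / real (Suc k))
          \<longlonglongrightarrow> 2 * t * Re (cinner K (T x) (T h) - f h) + t\<^sup>2 * (cnorm K (T h))\<^sup>2 + 0"
        by (intro tendsto_add tendsto_const tendsto_mult_left tendsto_Re tendsto_diff limT
            LIMSEQ_inverse_real_of_nat[unfolded inverse_eq_divide])
      moreover have "0 \<le> 2 * t * Re (cinner K (T (s k)) (T h) - f h) + t\<^sup>2 * (cnorm K (T h))\<^sup>2 + 1 / real (Suc k)" for k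
      proof -
        have "m \<le> J (s k \<oplus>\<^bsub>H\<^esub> of_real t \<odot>\<^bsub>H\<^esub> h)" by (intro m_le) simp
        then show ?thesis using J_line[of "s k" h t] Js[of k] by simp
      qed
      ultimately show "0 \<le> 2 * t * Re (cinner K (T x) (T h) - f h) + t\<^sup>2 * (cnorm K (T h))\<^sup>2"
        by (metis (no_types, lifting) LIMSEQ_le_const add_0_right)
    qed simp
    then show ?thesis by simp
  qed
  have "cinner K (T h) (T x) = f h" if h [simp]: "h \<in> carrier H" for h
  proof (rule complex_eqI)
    show "Re (cinner K (T h) (T x)) = Re (f h)"
      using Re_eq[OF h] K.cinner_commute[of "T h" "T x"] by simp
    \<comment> \<open>Real parts determine a complex linear functional: replacing \<open>h\<close>
      by \<open>\<i> h\<close> recovers the imaginary part.\<close>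
    have "Re (cinner K (T x) (T (\<i> \<odot>\<^bsub>H\<^esub> h))) = Re (f (\<i> \<odot>\<^bsub>H\<^esub> h))" by (rule Re_eq) simp
    then show "Im (cinner K (T h) (T x)) = Im (f h)"
      using K.cinner_commute[of "T h" "T x"]
      by (simp add: bounded_op_smult[OF T] f_smult K.cinner_simps)
  qed
  then show ?thesis using x by blast
qed

lemma (in chilbert) Riesz_representation:
  assumes "\<And>x y. \<lbrakk>x \<in> carrier H; y \<in> carrier H\<rbrakk> \<Longrightarrow> f (x \<oplus>\<^bsub>H\<^esub> y) = f x + f y"
    and "\<And>a x. x \<in> carrier H \<Longrightarrow> f (a \<odot>\<^bsub>H\<^esub> x) = a * f x"
    and "\<And>x. x \<in> carrier H \<Longrightarrow> cmod (f x) \<le> C * cnorm H x"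
  shows "\<exists>x\<in>carrier H. \<forall>h\<in>carrier H. cinner H h x = f h"
  using ex_representer[OF bounded_op_id chilbert_axioms chilbert_axioms, of 1 f C] assms by simp

lemma (in chilbert) eq_if_diff_eq_zero:
  assumes "x \<in> carrier H" "y \<in> carrier H" "x \<ominus>\<^bsub>H\<^esub> y = \<zero>\<^bsub>H\<^esub>"
  shows "x = y"
proof (rule vec_eqI)
  fix z assume "z \<in> carrier H"
  then show "cinner H x z = cinner H y z"
    using assms cinner_diff_left[of x y z] by (simp add: cinner_zero_left)
qed (use assms in auto)

text \<open>Representing the functional \<open>h \<mapsto> cinner K (T h) w\<close> gives an
  \<open>x\<close> for which \<open>T x - w\<close> is orthogonal to the range of \<open>T\<close>,
  hence zero. Closedness of the range does not have to be discussed.\<close>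

lemma surj_if_bounded_below:
  assumes T: "T \<in> bounded_op H K" and HK: "chilbert H" "chilbert K"
    and c: "0 < c" "\<And>x. x \<in> carrier H \<Longrightarrow> c * cnorm H x \<le> cnorm K (T x)"
    and dense: "\<And>y. \<lbrakk>y \<in> carrier K; \<And>h. h \<in> carrier H \<Longrightarrow> cinner K (T h) y = 0\<rbrakk> \<Longrightarrow> y = \<zero>\<^bsub>K\<^esub>"
    and w: "w \<in> carrier K"
  shows "\<exists>x\<in>carrier H. T x = w"
proof -
  interpret H: chilbert H by fact
  interpret K: chilbert K by fact
  note [simp] = bounded_op_mem[OF T] w
  obtain d where d: "\<And>x. x \<in> carrier H \<Longrightarrow> cnorm K (T x) \<le> d * cnorm H x"
    using bounded_op_bound T HK by metis
  have "cmod (cinner K (T x) w) \<le> d * cnorm K w * cnorm H x" if "x \<in> carrier H" for x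
  proof -
    have "cmod (cinner K (T x) w) \<le> cnorm K (T x) * cnorm K w"
      using that by (intro K.Cauchy_Schwarz) auto
    also have "\<dots> \<le> d * cnorm H x * cnorm K w"
      using d[OF that] by (intro mult_right_mono) auto
    finally show ?thesis by (simp add: mult_ac)
  qed
  then have "\<exists>x\<in>carrier H. \<forall>h\<in>carrier H. cinner K (T h) (T x) = cinner K (T h) w"
    using c T HK by (intro ex_representer[where c = c and C = "d * cnorm K w"])
      (auto simp: bounded_op_add bounded_op_smult K.cinner_simps)
  then obtain x where x [simp]: "x \<in> carrier H"
    and "\<And>h. h \<in> carrier H \<Longrightarrow> cinner K (T h) (T x) = cinner K (T h) w" by blast
  then have "T x \<ominus>\<^bsub>K\<^esub> w = \<zero>\<^bsub>K\<^esub>"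
    by (intro dense) (auto simp: K.cinner_simps)
  then show ?thesis
    using x K.eq_if_diff_eq_zero[of "T x" w] by auto
qed

lemma (in chilbert) vec_eqI_right:
  assumes "x \<in> carrier H" "y \<in> carrier H" "\<And>z. z \<in> carrier H \<Longrightarrow> cinner H z x = cinner H z y"
  shows "x = y"
  using assms by (metis vec_eqI cinner_commute)

text \<open>The value \<open>S y\<close> is the Riesz representer of
  \<open>x \<mapsto> cinner K (T x) y\<close>; extensionality makes the function unique, so that the
  description defining \<open>adj\<close> is justified.\<close>

lemma ex1_adj:
  assumes T: "T \<in> bounded_op H K" and HK: "chilbert H" "chilbert K"
  shows "\<exists>!S. S \<in> bounded_op K H \<and> S \<in> extensional (carrier K) \<and>
     (\<forall>x\<in>carrier H. \<forall>y\<in>carrier K. cinner K (T x) y = cinner H x (S y))"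
proof -
  interpret H: chilbert H by fact
  interpret K: chilbert K by fact
  note [simp] = bounded_op_mem[OF T]
  obtain d where d: "0 \<le> d" "\<And>x. x \<in> carrier H \<Longrightarrow> cnorm K (T x) \<le> d * cnorm H x"
    using bounded_op_bound T HK by metis
  have bd: "cmod (cinner K (T x) y) \<le> d * cnorm K y * cnorm H x"
    if "x \<in> carrier H" "y \<in> carrier K" for x y
  proof -
    have "cmod (cinner K (T x) y) \<le> cnorm K (T x) * cnorm K y"
      using that by (intro K.Cauchy_Schwarz) auto
    also have "\<dots> \<le> d * cnorm H x * cnorm K y"
      using d(2)[OF that(1)] that by (intro mult_right_mono) auto
    finally show ?thesis by (simp add: mult_ac)
  qed
  have "\<exists>z\<in>carrier H. \<forall>x\<in>carrier H. cinner H x z = cinner K (T x) y" if "y \<in> carrier K" for y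
    using that T bd[OF _ that]
    by (intro H.Riesz_representation[where C = "d * cnorm K y"])
      (auto simp: bounded_op_add bounded_op_smult K.cinner_simps)
  then obtain S0 where S0: "\<And>y. y \<in> carrier K \<Longrightarrow> S0 y \<in> carrier H"
    "\<And>x y. \<lbrakk>x \<in> carrier H; y \<in> carrier K\<rbrakk> \<Longrightarrow> cinner H x (S0 y) = cinner K (T x) y" by metis
  define S where "S = restrict S0 (carrier K)"
  have S [simp]: "\<And>y. y \<in> carrier K \<Longrightarrow> S y \<in> carrier H"
    "\<And>x y. \<lbrakk>x \<in> carrier H; y \<in> carrier K\<rbrakk> \<Longrightarrow> cinner H x (S y) = cinner K (T x) y"
    using S0 by (auto simp: S_def)
  have "S \<in> bounded_op K H"
  proof (rule bounded_opI[where c = d])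
    fix y assume y: "y \<in> carrier K"
    \<comment> \<open>Testing with \<open>x = S y\<close> bounds the square of the norm by a
      multiple of the norm, and one factor is cancelled.\<close>
    have "(cnorm H (S y))\<^sup>2 = cmod (cinner K (T (S y)) y)"
      using y H.cinner_self[of "S y"] by (simp del: of_real_power)
    also have "\<dots> \<le> d * cnorm K y * cnorm H (S y)" using y by (intro bd) auto
    finally have "cnorm H (S y) * cnorm H (S y) \<le> (d * cnorm K y) * cnorm H (S y)"
      by (simp add: power2_eq_square)
    then show "cnorm H (S y) \<le> d * cnorm K y"
      using d(1) y by (cases "cnorm H (S y) = 0") (auto dest: mult_right_le_imp_le simp: less_le)
  qed (auto intro!: H.vec_eqI_right simp: H.cinner_simps K.cinner_simps)
  moreover have "S \<in> extensional (carrier K)" by (simp add: S_def)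
  ultimately show ?thesis
  proof (intro ex1I[of _ S])
    fix R assume R: "R \<in> bounded_op K H \<and> R \<in> extensional (carrier K) \<and>
     (\<forall>x\<in>carrier H. \<forall>y\<in>carrier K. cinner K (T x) y = cinner H x (R y))"
    show "R = S"
    proof (rule extensionalityI[of _ "carrier K"])
      fix y assume "y \<in> carrier K"
      then show "R y = S y"
        using R by (intro H.vec_eqI_right) (auto simp: bounded_op_mem)
    qed (use R S_def in auto)
  qed auto
qed

lemmas adj_props = theI'[OF ex1_adj, folded adj_def]

lemma adj_bounded_op: "\<lbrakk>T \<in> bounded_op H K; chilbert H; chilbert K\<rbrakk> \<Longrightarrow> adj H K T \<in> bounded_op K H"
  using adj_props by blast

lemma cinner_adj:
  "\<lbrakk>T \<in> bounded_op H K; chilbert H; chilbert K; x \<in> carrier H; y \<in> carrier K\<rbrakk> \<Longrightarrow>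
    cinner H x (adj H K T y) = cinner K (T x) y"
  using adj_props by metis

lemma cinner_adj':
  assumes "T \<in> bounded_op H K" "chilbert H" "chilbert K" "x \<in> carrier H" "y \<in> carrier K"
  shows "cinner H (adj H K T y) x = cinner K y (T x)"
proof -
  have "cinner H (adj H K T y) x = cnj (cinner H x (adj H K T y))"
    using assms adj_bounded_op[OF assms(1-3)] by (intro chilbert.cinner_commute) (auto simp: bounded_op_mem)
  also have "\<dots> = cinner K y (T x)"
    using assms by (simp add: cinner_adj chilbert.cinner_commute[of K y] bounded_op_mem)
  finally show ?thesis .
qed

text \<open>The description evaluates \<open>T\<close> on the carrier only, so the adjoints coincide
  as functions even where \<open>T\<close> and \<open>T'\<close> differ elsewhere.\<close>

lemma adj_cong:
  assumes "\<And>x. x \<in> carrier H \<Longrightarrow> T x = T' x"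
  shows "adj H K T = adj H K T'"
  using assms by (simp add: adj_def)

lemma adj_eqI:
  assumes "T \<in> bounded_op H K" "chilbert H" "chilbert K" "y \<in> carrier K" "z \<in> carrier H"
    and "\<And>x. x \<in> carrier H \<Longrightarrow> cinner K (T x) y = cinner H x z"
  shows "adj H K T y = z"
  using assms adj_bounded_op[OF assms(1-3)]
  by (intro chilbert.vec_eqI_right[of H]) (auto simp: bounded_op_mem cinner_adj)

lemma adj_adj:
  assumes "T \<in> bounded_op H K" "chilbert H" "chilbert K" "x \<in> carrier H"
  shows "adj K H (adj H K T) x = T x"
  using assms adj_bounded_op[OF assms(1-3)]
  by (intro adj_eqI) (auto simp: bounded_op_mem cinner_adj')

lemma adj_comp:
  assumes "T \<in> bounded_op H K" "S \<in> bounded_op K L" "chilbert H" "chilbert K" "chilbert L" "y \<in> carrier L"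
  shows "adj H L (S \<circ> T) y = adj H K T (adj K L S y)"
  using assms adj_bounded_op[of T H K] adj_bounded_op[of S K L] bounded_op_comp[of T H K S L]
  by (intro adj_eqI) (auto simp: bounded_op_mem cinner_adj)

section \<open>Positive operators\<close>

lemma positive_op_bounded: "positive_op H S \<Longrightarrow> S \<in> bounded_op H H"
  by (simp add: positive_op_def)

lemma positive_op_Re: "\<lbrakk>positive_op H S; x \<in> carrier H\<rbrakk> \<Longrightarrow> 0 \<le> Re (cinner H (S x) x)"
  by (simp add: positive_op_def)

lemma positive_op_Im: "\<lbrakk>positive_op H S; x \<in> carrier H\<rbrakk> \<Longrightarrow> Im (cinner H (S x) x) = 0"
  by (simp add: positive_op_def complex_is_Real_iff)

context chilbert
begin

text \<open>Polarisation: reality of the form at \<open>x + y\<close> matches the imaginary parts of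
  \<open>cinner H (S x) y\<close> and the conjugate of \<open>cinner H (S y) x\<close>, and reality
  at \<open>x + \<i> y\<close> matches their real parts.\<close>

lemma positive_op_selfadjoint:
  assumes S: "positive_op H S" and xy: "x \<in> carrier H" "y \<in> carrier H"
  shows "cinner H (S x) y = cinner H x (S y)"
proof -
  note b = positive_op_bounded[OF S]
  note [simp] = bounded_op_mem[OF b] xy
  note sm = bounded_op_add[OF b] bounded_op_smult[OF b] cinner_simps positive_op_Im[OF S]
  have "Im (cinner H (S (x \<oplus> y)) (x \<oplus> y)) = 0"
    by (rule positive_op_Im[OF S]) simp
  moreover have "Im (cinner H (S (x \<oplus> \<i> \<odot> y)) (x \<oplus> \<i> \<odot> y)) = 0"
    by (rule positive_op_Im[OF S]) simp
  ultimately have "cinner H (S x) y = cnj (cinner H (S y) x)"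
    by (simp add: sm complex_eq_iff)
  then show ?thesis by (simp add: cinner_commute[of x])
qed

text \<open>The form \<open>cinner H (S x) y\<close> is only semidefinite, so the quadratic argument
  is needed with a leading coefficient that may vanish for nonzero \<open>y\<close>.\<close>

lemma positive_op_Cauchy_Schwarz:
  assumes S: "positive_op H S" and xy: "x \<in> carrier H" "y \<in> carrier H"
  shows "(cmod (cinner H (S x) y))\<^sup>2 \<le> Re (cinner H (S x) x) * Re (cinner H (S y) y)"
proof (rule norm_sq_le_mult_if_quadratic_nonneg)
  note b = positive_op_bounded[OF S]
  note [simp] = bounded_op_mem[OF b] xy
  fix a
  have 1: "cinner H (S y) x = cnj (cinner H (S x) y)"
    using positive_op_selfadjoint[OF S, of y x] by (simp add: cinner_commute[of y])
  have "0 \<le> Re (cinner H (S (x \<oplus> cnj a \<odot> y)) (x \<oplus> cnj a \<odot> y))"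
    by (rule positive_op_Re[OF S]) simp
  then show "0 \<le> Re (cinner H (S x) x) + 2 * Re (a * cinner H (S x) y) + (cmod a)\<^sup>2 * Re (cinner H (S y) y)"
    using positive_op_Im[OF S, of y] unfolding cmod_power2
    by (simp add: bounded_op_add[OF b] bounded_op_smult[OF b] cinner_simps 1
        power2_eq_square algebra_simps)
qed (rule positive_op_Re[OF S xy(2)])

lemma positive_op_eq_zero:
  assumes S: "positive_op H S" and x: "x \<in> carrier H" "Re (cinner H (S x) x) = 0"
  shows "S x = \<zero>\<^bsub>H\<^esub>"
proof -
  have Sx: "S x \<in> carrier H" using positive_op_bounded[OF S] x(1) by (rule bounded_op_mem)
  then have "(cmod (cinner H (S x) (S x)))\<^sup>2 \<le> 0"
    using positive_op_Cauchy_Schwarz[OF S x(1) Sx] x by simp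
  then show ?thesis
    using Sx by (intro cinner_definite) auto
qed

end

lemma positive_op_adj_comp:
  assumes "T \<in> bounded_op H K" "chilbert H" "chilbert K"
  shows "positive_op H (adj H K T \<circ> T)"
  using assms bounded_op_comp[OF assms(1) adj_bounded_op[OF assms]]
    chilbert.cinner_self[of K]
  by (auto simp: positive_op_def cinner_adj' bounded_op_mem simp del: of_real_power)

section \<open>The square root of a positive operator\<close>

text \<open>For a positive contraction \<open>D\<close> the iterates \<open>Y (Suc n) = (D + Y n * Y n) / 2\<close> converge to \<open>Y\<close>
  with \<open>(1 - Y)\<^sup>2 = 1 - D\<close>; their increments are dominated by those of the scalar iteration
  with \<open>D = 1\<close>.\<close>

primrec sqrt_iter :: "('a, 'm) cinner_space_scheme \<Rightarrow> ('a \<Rightarrow> 'a) \<Rightarrow> nat \<Rightarrow> 'a \<Rightarrow> 'a" where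
  "sqrt_iter H D 0 = (\<lambda>x. \<zero>\<^bsub>H\<^esub>)"
| "sqrt_iter H D (Suc n) =
    (\<lambda>x. (1 / 2) \<odot>\<^bsub>H\<^esub> (D x \<oplus>\<^bsub>H\<^esub> sqrt_iter H D n (sqrt_iter H D n x)))"

primrec scalar_iter :: "nat \<Rightarrow> real" where
  "scalar_iter 0 = 0"
| "scalar_iter (Suc n) = (1 + (scalar_iter n)\<^sup>2) / 2"

lemma scalar_iter_nonneg [simp]: "0 \<le> scalar_iter n"
  by (induction n) auto

lemma scalar_iter_le_1: "scalar_iter n \<le> 1"
proof (induction n)
  case (Suc n)
  then have "(scalar_iter n)\<^sup>2 \<le> 1" by (simp add: power_le_one)
  then show ?case by simp
qed simp

lemma scalar_iter_le_Suc: "scalar_iter n \<le> scalar_iter (Suc n)"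
proof -
  have "0 \<le> (scalar_iter n - 1)\<^sup>2" by simp
  then show ?thesis by (simp add: power2_diff)
qed

lemma convergent_scalar_iter: "convergent scalar_iter"
  using scalar_iter_le_1 scalar_iter_le_Suc
  by (intro Bseq_mono_convergent BseqI'[where K = 1] monoI) (auto simp: lift_Suc_mono_le)

lemma (in chilbert) tendsto_cinner2:
  assumes s: "(\<lambda>k. cnorm H (s k \<ominus> x)) \<longlonglongrightarrow> 0" and t: "(\<lambda>k. cnorm H (t k \<ominus> y)) \<longlonglongrightarrow> 0"
    and mem [simp]: "\<And>k. s k \<in> carrier H" "x \<in> carrier H" "\<And>k. t k \<in> carrier H" "y \<in> carrier H"
  shows "(\<lambda>k. cinner H (s k) (t k)) \<longlonglongrightarrow> cinner H x y"
proof (rule Lim_null_comparison[OF always_eventually, THEN LIM_zero_cancel], rule allI)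
  fix k
  have "cinner H (s k) (t k) - cinner H x y
      = cinner H (s k \<ominus> x) (t k) + cinner H x (t k \<ominus> y)"
    by (simp add: cinner_simps)
  also have "norm \<dots> \<le> cmod (cinner H (s k \<ominus> x) (t k)) + cmod (cinner H x (t k \<ominus> y))"
    by (rule norm_triangle_ineq)
  also have "\<dots> \<le> cnorm H (s k \<ominus> x) * cnorm H (t k) + cnorm H x * cnorm H (t k \<ominus> y)"
    by (intro add_mono Cauchy_Schwarz) auto
  finally show "norm (cinner H (s k) (t k) - cinner H x y)
      \<le> cnorm H (s k \<ominus> x) * cnorm H (t k) + cnorm H x * cnorm H (t k \<ominus> y)" .
next
  have "(\<lambda>k. cnorm H (s k \<ominus> x) * cnorm H (t k) + cnorm H x * cnorm H (t k \<ominus> y))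
      \<longlonglongrightarrow> 0 * cnorm H y + cnorm H x * 0"
    by (intro tendsto_intros s t tendsto_cnorm) auto
  then show "(\<lambda>k. cnorm H (s k \<ominus> x) * cnorm H (t k) + cnorm H x * cnorm H (t k \<ominus> y)) \<longlonglongrightarrow> 0"
    by simp
qed

lemma sqrt_iter_bounded_op:
  assumes "D \<in> bounded_op H H" "chilbert H"
  shows "sqrt_iter H D n \<in> bounded_op H H"
proof (induction n)
  case 0
  interpret chilbert H by fact
  show ?case
    by (rule bounded_opI[where c = 0]) (auto intro!: vec_eqI simp: cinner_simps)
next
  case (Suc n)
  have "(\<lambda>x. (1 / 2) \<odot>\<^bsub>H\<^esub> (D x \<oplus>\<^bsub>H\<^esub> (sqrt_iter H D n \<circ> sqrt_iter H D n) x)) \<in> bounded_op H H"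
    using assms Suc by (intro bounded_op_op_scale bounded_op_op_add bounded_op_comp)
  then show ?case by simp
qed

text \<open>Each iterate is a polynomial in \<open>D\<close>, so a relation
  \<open>V D = D' V\<close> carries over. Two spaces are allowed because \<open>V\<close> will later
  be an operator \<open>T\<close> itself, with \<open>D\<close> and \<open>D'\<close> coming from
  its two products with the adjoint.\<close>

lemma sqrt_iter_intertwine:
  assumes V: "V \<in> bounded_op H K" and HK: "chilbert H" "chilbert K"
    and D: "D \<in> bounded_op H H" "D' \<in> bounded_op K K"
    and VD: "\<And>x. x \<in> carrier H \<Longrightarrow> V (D x) = D' (V x)"
    and x: "x \<in> carrier H"
  shows "V (sqrt_iter H D n x) = sqrt_iter K D' n (V x)"
  using x
proof (induction n arbitrary: x)
  case 0
  interpret H: chilbert H by fact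
  interpret K: chilbert K by fact
  have "0 \<odot>\<^bsub>H\<^esub> \<zero>\<^bsub>H\<^esub> = \<zero>\<^bsub>H\<^esub>"
    by (intro H.vec_eqI) (auto simp: H.cinner_simps)
  then have "V \<zero>\<^bsub>H\<^esub> = 0 \<odot>\<^bsub>K\<^esub> V \<zero>\<^bsub>H\<^esub>"
    using bounded_op_smult[OF V, of "\<zero>\<^bsub>H\<^esub>" 0] by simp
  moreover have "0 \<odot>\<^bsub>K\<^esub> V \<zero>\<^bsub>H\<^esub> = \<zero>\<^bsub>K\<^esub>"
    using bounded_op_mem[OF V, of "\<zero>\<^bsub>H\<^esub>"] by (intro K.vec_eqI) (auto simp: K.cinner_simps)
  ultimately show ?case by simp
next
  case (Suc n)
  interpret H: chilbert H by fact
  interpret K: chilbert K by fact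
  note [simp] = bounded_op_mem[OF V] bounded_op_mem[OF D(1)]
    bounded_op_mem[OF sqrt_iter_bounded_op[OF D(1) HK(1)]]
  show ?case
    using Suc by (simp add: bounded_op_smult[OF V] bounded_op_add[OF V] VD)
qed

section \<open>The limit of the iteration for a positive contraction\<close>

definition sqrt_lim :: "('a, 'm) cinner_space_scheme \<Rightarrow> ('a \<Rightarrow> 'a) \<Rightarrow> 'a \<Rightarrow> 'a" where
  "sqrt_lim H D x = (SOME y. y \<in> carrier H \<and> (\<lambda>k. cnorm H (sqrt_iter H D k x \<ominus>\<^bsub>H\<^esub> y)) \<longlonglongrightarrow> 0)"

locale positive_contraction = chilbert H for H :: "('a, 'm) cinner_space_scheme" (structure) +
  fixes D :: "'a \<Rightarrow> 'a"
  assumes D: "positive_op H D"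
    and D_contr: "\<And>x. x \<in> carrier H \<Longrightarrow> cnorm H (D x) \<le> cnorm H x"
begin

abbreviation "Y \<equiv> sqrt_iter H D"

lemmas D_bounded = positive_op_bounded[OF D]
lemmas Y_bounded = sqrt_iter_bounded_op[OF D_bounded chilbert_axioms]

lemmas D_mem [simp] = bounded_op_mem[OF D_bounded]
lemmas Y_mem [simp] = bounded_op_mem[OF Y_bounded]

text \<open>Intertwining is used twice: \<open>V = D\<close> shows that \<open>D\<close> commutes
  with every iterate, and then \<open>V = Y m\<close> shows that the iterates commute with each
  other.\<close>

lemma Y_commute: "x \<in> carrier H \<Longrightarrow> Y m (Y n x) = Y n (Y m x)"
proof -
  assume x: "x \<in> carrier H"
  have "D (Y n x) = Y n (D x)" if "x \<in> carrier H" for n x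
    by (rule sqrt_iter_intertwine[OF D_bounded chilbert_axioms chilbert_axioms D_bounded D_bounded refl that])
  then show ?thesis
    by (intro sqrt_iter_intertwine[OF Y_bounded chilbert_axioms chilbert_axioms D_bounded D_bounded _ x]) auto
qed

lemma Y_selfadjoint: "\<lbrakk>x \<in> carrier H; y \<in> carrier H\<rbrakk> \<Longrightarrow> cinner H (Y n x) y = cinner H x (Y n y)"
proof (induction n arbitrary: x y)
  case (Suc n)
  then show ?case
    by (simp add: cinner_simps positive_op_selfadjoint[OF D])
qed (simp add: cinner_simps)

lemma Y_bound: "x \<in> carrier H \<Longrightarrow> cnorm H (Y n x) \<le> scalar_iter n * cnorm H x"
proof (induction n arbitrary: x)
  case (Suc n)
  have "cnorm H (Y n (Y n x)) \<le> scalar_iter n * (scalar_iter n * cnorm H x)"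
    using Suc.IH[of "Y n x"] mult_left_mono[OF Suc.IH[OF Suc.prems], of "scalar_iter n"] Suc.prems by simp
  then have "cnorm H (D x \<oplus> Y n (Y n x)) \<le> cnorm H x + scalar_iter n * (scalar_iter n * cnorm H x)"
    using cnorm_triangle[of "D x" "Y n (Y n x)"] D_contr[OF Suc.prems] Suc.prems by simp
  then show ?case
    using Suc.prems by (simp add: cnorm_smult power2_eq_square algebra_simps)
qed simp

text \<open>Since the iterates commute, the difference of the squares factors as
  \<open>(Y (Suc n) + Y n) (Y (Suc n) - Y n)\<close>. The first factor is bounded by
  \<open>Y_bound\<close>, the second by induction, and the increments of \<open>scalar_iter\<close>
  factor in the same way.\<close>

lemma Y_increment:
  "x \<in> carrier H \<Longrightarrow> cnorm H (Y (Suc n) x \<ominus> Y n x) \<le> (scalar_iter (Suc n) - scalar_iter n) * cnorm H x"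
proof (induction n arbitrary: x)
  case 0
  have "Y (Suc 0) x \<ominus> Y 0 x = (1/2) \<odot> D x"
    using 0 by (intro vec_eqI) (auto simp: cinner_simps)
  then show ?case using D_contr[OF 0] 0 by (simp add: cnorm_smult)
next
  case (Suc n)
  define w where "w = Y (Suc n) x \<ominus> Y n x"
  have w [simp]: "w \<in> carrier H" using Suc.prems by (simp add: w_def del: sqrt_iter.simps)
  have "Y (Suc (Suc n)) x \<ominus> Y (Suc n) x = (1/2) \<odot> (Y (Suc n) (Y (Suc n) x) \<ominus> Y n (Y n x))"
    using Suc.prems by (intro vec_eqI)
      (auto simp: cinner_simps algebra_simps sqrt_iter.simps(2)[of _ _ "Suc n"]
        simp del: sqrt_iter.simps, simp add: cinner_simps)
  also have "Y (Suc n) (Y (Suc n) x) \<ominus> Y n (Y n x) = Y (Suc n) w \<oplus> Y n w"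
    using Suc.prems Y_commute[of x n "Suc n"] unfolding w_def
    by (intro vec_eqI) (auto simp: cinner_simps bounded_op_diff[OF Y_bounded chilbert_axioms chilbert_axioms]
        simp del: sqrt_iter.simps)
  finally have "cnorm H (Y (Suc (Suc n)) x \<ominus> Y (Suc n) x) = cnorm H (Y (Suc n) w \<oplus> Y n w) / 2"
    by (simp add: cnorm_smult del: sqrt_iter.simps)
  also have "\<dots> \<le> (scalar_iter (Suc n) * cnorm H w + scalar_iter n * cnorm H w) / 2"
    using cnorm_triangle[of "Y (Suc n) w" "Y n w"] Y_bound[of w "Suc n"] Y_bound[of w n]
    by (simp del: sqrt_iter.simps scalar_iter.simps)
  also have "\<dots> = (scalar_iter (Suc n) + scalar_iter n) / 2 * cnorm H w"
    by (simp add: distrib_right del: scalar_iter.simps)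
  also have "\<dots> \<le> (scalar_iter (Suc n) + scalar_iter n) / 2 * ((scalar_iter (Suc n) - scalar_iter n) * cnorm H x)"
    using Suc.IH[OF Suc.prems] by (intro mult_left_mono) (auto simp: w_def simp del: sqrt_iter.simps scalar_iter.simps)
  also have "\<dots> = (scalar_iter (Suc (Suc n)) - scalar_iter (Suc n)) * cnorm H x"
  proof -
    have eq: "scalar_iter (Suc (Suc n)) - scalar_iter (Suc n) = ((scalar_iter (Suc n))\<^sup>2 - (scalar_iter n)\<^sup>2) / 2"
      using scalar_iter.simps(2)[of "Suc n"] scalar_iter.simps(2)[of n] by argo
    show ?thesis
      unfolding eq by (simp add: field_simps power2_eq_square del: scalar_iter.simps)
  qed
  finally show ?case .
qed

lemma Y_dist:
  assumes x: "x \<in> carrier H" and "n \<le> m"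
  shows "cnorm H (Y m x \<ominus> Y n x) \<le> (scalar_iter m - scalar_iter n) * cnorm H x"
  using \<open>n \<le> m\<close>
proof (induction m rule: dec_induct)
  case base
  have "Y n x \<ominus> Y n x = \<zero>" using x by (intro vec_eqI) (auto simp: cinner_simps)
  then show ?case by simp
next
  case (step m)
  have "Y (Suc m) x \<ominus> Y n x = (Y (Suc m) x \<ominus> Y m x) \<oplus> (Y m x \<ominus> Y n x)"
    using x by (intro vec_eqI) (auto simp: cinner_simps simp del: sqrt_iter.simps)
  then have "cnorm H (Y (Suc m) x \<ominus> Y n x) \<le> cnorm H (Y (Suc m) x \<ominus> Y m x) + cnorm H (Y m x \<ominus> Y n x)"
    using x by (simp add: cnorm_triangle del: sqrt_iter.simps)
  then show ?case
    using step.IH Y_increment[OF x, of m] by (simp add: left_diff_distrib del: sqrt_iter.simps scalar_iter.simps)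
qed

lemma ex_sqrt_lim:
  assumes x [simp]: "x \<in> carrier H"
  shows "\<exists>y. y \<in> carrier H \<and> (\<lambda>k. cnorm H (Y k x \<ominus> y)) \<longlonglongrightarrow> 0"
proof -
  have "\<exists>y\<in>carrier H. (\<lambda>k. cnorm H (Y k x \<ominus> y)) \<longlonglongrightarrow> 0"
  proof (rule complete)
    fix e :: real assume "0 < e"
    \<comment> \<open>The summand \<open>1\<close> keeps the divisor positive when \<open>x\<close>
      is zero.\<close>
    moreover have "0 < cnorm H x + 1" using cnorm_nonneg[OF x] by linarith
    ultimately have e: "0 < e / (cnorm H x + 1)" by simp
    have "Cauchy scalar_iter" using convergent_scalar_iter by (rule convergent_Cauchy)
    then obtain N where N: "\<And>m n. \<lbrakk>N \<le> m; N \<le> n\<rbrakk> \<Longrightarrow> \<bar>scalar_iter m - scalar_iter n\<bar> < e / (cnorm H x + 1)"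
      using e unfolding Cauchy_def dist_real_def by metis
    have *: "cnorm H (Y m x \<ominus> Y n x) < e" if "N \<le> n" "n \<le> m" for m n
    proof -
      have "cnorm H (Y m x \<ominus> Y n x) \<le> (scalar_iter m - scalar_iter n) * cnorm H x"
        using that by (intro Y_dist) auto
      also have "\<dots> \<le> e / (cnorm H x + 1) * cnorm H x"
        using N[of m n] that by (intro mult_right_mono) auto
      also have "\<dots> < e"
        using \<open>0 < e\<close> \<open>0 < cnorm H x + 1\<close> by (simp add: field_simps)
      finally show ?thesis .
    qed
    have "Y m x \<ominus> Y n x = \<ominus> (Y n x \<ominus> Y m x)" for m n
      by (intro vec_eqI) (auto simp: cinner_simps)
    then have "cnorm H (Y m x \<ominus> Y n x) = cnorm H (Y n x \<ominus> Y m x)" for m n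
      by (metis Y_mem M.minus_closed cnorm_uminus x)
    then have "cnorm H (Y m x \<ominus> Y n x) < e" if "N \<le> m" "N \<le> n" for m n
      using *[of m n] *[of n m] that by (metis nle_le)
    then show "\<exists>N. \<forall>m\<ge>N. \<forall>k\<ge>N. cnorm H (Y m x \<ominus> Y k x) < e" by blast
  qed auto
  then show ?thesis by blast
qed

abbreviation "L \<equiv> sqrt_lim H D"

lemma
  assumes "x \<in> carrier H"
  shows L_mem [simp]: "L x \<in> carrier H"
    and L_lim: "(\<lambda>k. cnorm H (Y k x \<ominus> L x)) \<longlonglongrightarrow> 0"
  using someI_ex[OF ex_sqrt_lim[OF assms]] by (auto simp: sqrt_lim_def)

lemma tendsto_Y: "\<lbrakk>x \<in> carrier H; z \<in> carrier H\<rbrakk> \<Longrightarrow> (\<lambda>k. cinner H (Y k x) z) \<longlonglongrightarrow> cinner H (L x) z"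
  by (rule tendsto_cinner[OF L_lim]) auto

lemma L_contr:
  assumes [simp]: "x \<in> carrier H"
  shows "cnorm H (L x) \<le> cnorm H x"
proof (rule LIMSEQ_le_const2[OF tendsto_cnorm[OF L_lim]])
  have "cnorm H (Y k x) \<le> cnorm H x" for k
    using Y_bound[of x k] mult_right_mono[OF scalar_iter_le_1[of k], of "cnorm H x"] by simp
  then show "\<exists>N. \<forall>k\<ge>N. cnorm H (Y k x) \<le> cnorm H x"
    by blast
qed auto

lemma L_bounded: "L \<in> bounded_op H H"
proof (rule bounded_opI[where c = 1])
  fix x y assume [simp]: "x \<in> carrier H" "y \<in> carrier H"
  show "L (x \<oplus> y) = L x \<oplus> L y"
  proof (rule vec_eqI)
    fix z assume [simp]: "z \<in> carrier H"
    have "(\<lambda>k. cinner H (Y k x) z + cinner H (Y k y) z) \<longlonglongrightarrow> cinner H (L x) z + cinner H (L y) z"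
      by (intro tendsto_add tendsto_Y) auto
    then have "(\<lambda>k. cinner H (Y k (x \<oplus> y)) z) \<longlonglongrightarrow> cinner H (L x \<oplus> L y) z"
      by (simp add: bounded_op_add[OF Y_bounded] cinner_add_left)
    then show "cinner H (L (x \<oplus> y)) z = cinner H (L x \<oplus> L y) z"
      using LIMSEQ_unique tendsto_Y[of "x \<oplus> y" z] by simp
  qed auto
next
  fix a x assume [simp]: "x \<in> carrier H"
  show "L (a \<odot> x) = a \<odot> L x"
  proof (rule vec_eqI)
    fix z assume [simp]: "z \<in> carrier H"
    have "(\<lambda>k. a * cinner H (Y k x) z) \<longlonglongrightarrow> a * cinner H (L x) z"
      by (intro tendsto_mult_left tendsto_Y) auto
    then have "(\<lambda>k. cinner H (Y k (a \<odot> x)) z) \<longlonglongrightarrow> cinner H (a \<odot> L x) z"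
      by (simp add: bounded_op_smult[OF Y_bounded] cinner_smult_left)
    then show "cinner H (L (a \<odot> x)) z = cinner H (a \<odot> L x) z"
      using LIMSEQ_unique tendsto_Y[of "a \<odot> x" z] by simp
  qed auto
next
  fix x assume "x \<in> carrier H"
  then show "cnorm H (L x) \<le> 1 * cnorm H x" using L_contr by simp
qed simp

lemma L_selfadjoint: "\<lbrakk>x \<in> carrier H; y \<in> carrier H\<rbrakk> \<Longrightarrow> cinner H (L x) y = cinner H x (L y)"
proof -
  assume xy [simp]: "x \<in> carrier H" "y \<in> carrier H"
  have "(\<lambda>k. cnj (cinner H (Y k y) x)) \<longlonglongrightarrow> cnj (cinner H (L y) x)"
    by (intro tendsto_cnj tendsto_Y) auto
  moreover have "cnj (cinner H (Y k y) x) = cinner H (Y k x) y" for k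
    using Y_selfadjoint[of x y k] cinner_commute[of x "Y k y"] by simp
  moreover have "cnj (cinner H (L y) x) = cinner H x (L y)"
    using cinner_commute[of x "L y"] by simp
  ultimately have "(\<lambda>k. cinner H (Y k x) y) \<longlonglongrightarrow> cinner H x (L y)"
    by (simp only:)
  then show ?thesis
    by (rule LIMSEQ_unique[OF tendsto_Y[OF xy]])
qed

text \<open>This is \<open>2 Y = D + Y\<^sup>2\<close> in the limit, tested against
  \<open>z\<close>. Self-adjointness moves one of the two factors \<open>Y k\<close> onto
  \<open>z\<close>, so that joint continuity of the inner product suffices for the quadratic
  term.\<close>

lemma L_fixpoint:
  assumes [simp]: "x \<in> carrier H" "z \<in> carrier H"
  shows "2 * cinner H (L x) z = cinner H (D x) z + cinner H (L (L x)) z"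
proof -
  have "(\<lambda>k. cinner H (D x) z + cinner H (Y k x) (Y k z)) \<longlonglongrightarrow> cinner H (D x) z + cinner H (L x) (L z)"
    by (intro tendsto_add tendsto_const tendsto_cinner2 L_lim) auto
  moreover have "cinner H (D x) z + cinner H (Y k x) (Y k z) = 2 * cinner H (Y (Suc k) x) z" for k
    using Y_selfadjoint[of "Y k x" z k] by (simp add: cinner_simps)
  ultimately have "(\<lambda>k. 2 * cinner H (Y (Suc k) x) z) \<longlonglongrightarrow> cinner H (D x) z + cinner H (L (L x)) z"
    using L_selfadjoint[of "L x" z] by simp
  moreover have "(\<lambda>k. 2 * cinner H (Y (Suc k) x) z) \<longlonglongrightarrow> 2 * cinner H (L x) z"
    by (intro tendsto_mult_left LIMSEQ_Suc tendsto_Y) auto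
  ultimately show ?thesis
    by (rule LIMSEQ_unique[symmetric])
qed

end

lemma sqrt_lim_intertwine:
  assumes V: "V \<in> bounded_op H K" and "positive_contraction H D" "positive_contraction K D'"
    and VD: "\<And>x. x \<in> carrier H \<Longrightarrow> V (D x) = D' (V x)"
    and x: "x \<in> carrier H"
  shows "V (sqrt_lim H D x) = sqrt_lim K D' (V x)"
proof -
  interpret H: positive_contraction H D by fact
  interpret K: positive_contraction K D' by fact
  note [simp] = x bounded_op_mem[OF V]
  show ?thesis
  proof (rule K.vec_eqI)
    fix z assume [simp]: "z \<in> carrier K"
    have "(\<lambda>k. cinner K (V (H.Y k x)) z) \<longlonglongrightarrow> cinner K (V (H.L x)) z"
      by (rule K.tendsto_cinner[OF tendsto_bounded_op[OF V H.chilbert_axioms K.chilbert_axioms H.L_lim]]) auto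
    moreover have "V (H.Y k x) = K.Y k (V x)" for k
      by (rule sqrt_iter_intertwine[OF V H.chilbert_axioms K.chilbert_axioms H.D_bounded K.D_bounded VD x])
    ultimately show "cinner K (V (H.L x)) z = cinner K (K.L (V x)) z"
      using LIMSEQ_unique K.tendsto_Y[of "V x" z] by simp
  qed auto
qed

section \<open>Square roots of arbitrary positive operators by rescaling\<close>

definition complement_op :: "('a, 'm) cinner_space_scheme \<Rightarrow> real \<Rightarrow> ('a \<Rightarrow> 'a) \<Rightarrow> 'a \<Rightarrow> 'a" where
  "complement_op H c T = (\<lambda>x. x \<oplus>\<^bsub>H\<^esub> complex_of_real (- 1 / c) \<odot>\<^bsub>H\<^esub> T x)"

text \<open>The operator \<open>D = 1 - T / c\<close> satisfies \<open>0 \<le> D \<le> 1\<close> as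
  a quadratic form. Cauchy-Schwarz for this form at \<open>x\<close> and \<open>D x\<close> bounds
  the fourth power of the norm of \<open>D x\<close> by the product of the squared norms of
  \<open>x\<close> and \<open>D x\<close>, which gives contractivity.\<close>

lemma positive_contraction_complement_op:
  assumes H: "chilbert H" and T: "positive_op H T" and c: "0 < c"
    "\<And>x. x \<in> carrier H \<Longrightarrow> cnorm H (T x) \<le> c * cnorm H x"
  shows "positive_contraction H (complement_op H c T)"
proof -
  interpret chilbert H by fact
  let ?D = "complement_op H c T"
  note Tb = positive_op_bounded[OF T]
  note [simp] = bounded_op_mem[OF Tb]
  have Db: "?D \<in> bounded_op H H"
    unfolding complement_op_def by (intro bounded_op_op_add bounded_op_op_scale bounded_op_id Tb H)
  note [simp] = bounded_op_mem[OF Db]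
  have D_inner: "cinner H (?D x) x = of_real ((cnorm H x)\<^sup>2 - Re (cinner H (T x) x) / c)"
    if x: "x \<in> carrier H" for x
    using x positive_op_Im[OF T x] by (simp add: complement_op_def cinner_simps cinner_self complex_eq_iff)
  have T_le: "Re (cinner H (T x) x) \<le> c * (cnorm H x)\<^sup>2" if x: "x \<in> carrier H" for x
  proof -
    have "Re (cinner H (T x) x) \<le> cnorm H (T x) * cnorm H x"
      using Cauchy_Schwarz[of "T x" x] x complex_Re_le_cmod order_trans by fastforce
    also have "\<dots> \<le> c * cnorm H x * cnorm H x"
      using c(2)[OF x] x by (intro mult_right_mono) auto
    finally show ?thesis by (simp add: power2_eq_square)
  qed
  have D_pos: "positive_op H ?D"
    unfolding positive_op_def
  proof (intro conjI ballI Db)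
    fix x assume x: "x \<in> carrier H"
    show "cinner H (?D x) x \<in> \<real>" unfolding D_inner[OF x] by simp
    show "0 \<le> Re (cinner H (?D x) x)"
      unfolding D_inner[OF x] using T_le[OF x] c(1) by (simp add: field_simps)
  qed
  have D_le: "Re (cinner H (?D x) x) \<le> (cnorm H x)\<^sup>2" if x: "x \<in> carrier H" for x
    unfolding D_inner[OF x] using positive_op_Re[OF T x] c(1) by simp
  show ?thesis
  proof (intro positive_contraction.intro H positive_contraction_axioms.intro D_pos)
    fix x assume x: "x \<in> carrier H"
    have "(cmod (cinner H (?D x) (?D x)))\<^sup>2 \<le> (cnorm H x)\<^sup>2 * (cnorm H (?D x))\<^sup>2"
      using positive_op_Cauchy_Schwarz[OF D_pos x, of "?D x"] D_le[of x] D_le[of "?D x"] x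
        mult_mono[OF D_le[of x] D_le[of "?D x"]] positive_op_Re[OF D_pos, of "?D x"]
      by simp
    then have "((cnorm H (?D x))\<^sup>2)\<^sup>2 \<le> (cnorm H x)\<^sup>2 * (cnorm H (?D x))\<^sup>2"
      using x by (simp add: cinner_self norm_power)
    then have *: "(cnorm H (?D x))\<^sup>2 * (cnorm H (?D x))\<^sup>2 \<le> (cnorm H x)\<^sup>2 * (cnorm H (?D x))\<^sup>2"
      by (simp only: power2_eq_square)
    have "(cnorm H (?D x))\<^sup>2 \<le> (cnorm H x)\<^sup>2"
    proof (cases "cnorm H (?D x) = 0")
      case False
      then show ?thesis using mult_right_le_imp_le[OF *] by simp
    qed simp
    then show "cnorm H (?D x) \<le> cnorm H x"
      using x by (simp add: power2_le_iff_abs_le)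
  qed
qed

text \<open>With \<open>D = 1 - T / c\<close> the iteration yields
  \<open>(1 - Y)\<^sup>2 = T / c\<close>, whence the factor \<open>sqrt c\<close>. The restriction
  to the carrier meets the extensionality clause of \<open>op_sqrt\<close>.\<close>

definition pos_root :: "('a, 'm) cinner_space_scheme \<Rightarrow> real \<Rightarrow> ('a \<Rightarrow> 'a) \<Rightarrow> 'a \<Rightarrow> 'a" where
  "pos_root H c T = (\<lambda>x\<in>carrier H. complex_of_real (sqrt c) \<odot>\<^bsub>H\<^esub>
     (x \<oplus>\<^bsub>H\<^esub> (- 1) \<odot>\<^bsub>H\<^esub> sqrt_lim H (complement_op H c T) x))"

context
  fixes H :: "('a, 'm) cinner_space_scheme" and c :: real and T :: "'a \<Rightarrow> 'a"
  assumes H: "chilbert H" and T: "positive_op H T" and c: "0 < c"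
    "\<And>x. x \<in> carrier H \<Longrightarrow> cnorm H (T x) \<le> c * cnorm H x"
begin

interpretation positive_contraction H "complement_op H c T"
  by (rule positive_contraction_complement_op[OF H T c])

lemma positive_op_pos_root: "positive_op H (pos_root H c T)"
  unfolding positive_op_def
proof (intro conjI ballI)
  have "(\<lambda>x. complex_of_real (sqrt c) \<odot>\<^bsub>H\<^esub> (x \<oplus>\<^bsub>H\<^esub> (- 1) \<odot>\<^bsub>H\<^esub> L x)) \<in> bounded_op H H"
    by (intro bounded_op_op_add bounded_op_op_scale bounded_op_id L_bounded H)
  then show "pos_root H c T \<in> bounded_op H H"
    unfolding bounded_op_def pos_root_def by (simp add: Pi_iff)
next
  fix x assume x [simp]: "x \<in> carrier H"
  have "cinner H (L x) x = cnj (cinner H (L x) x)"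
    using L_selfadjoint[of x x] cinner_commute[of x "L x"] by simp
  then have Im: "Im (cinner H (L x) x) = 0"
    by (simp add: complex_eq_iff)
  have *: "cinner H (pos_root H c T x) x = of_real (sqrt c * ((cnorm H x)\<^sup>2 - Re (cinner H (L x) x)))"
    using Im by (simp add: pos_root_def cinner_simps cinner_self complex_eq_iff)
  show "cinner H (pos_root H c T x) x \<in> \<real>"
    unfolding * by simp
  have "Re (cinner H (L x) x) \<le> cnorm H (L x) * cnorm H x"
    using Cauchy_Schwarz[of "L x" x] complex_Re_le_cmod order_trans by fastforce
  also have "\<dots> \<le> cnorm H x * cnorm H x"
    by (intro mult_right_mono L_contr) auto
  finally show "0 \<le> Re (cinner H (pos_root H c T x) x)"
    unfolding * using c(1) by (simp add: power2_eq_square)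
qed

lemma pos_root_square:
  assumes x [simp]: "x \<in> carrier H"
  shows "pos_root H c T (pos_root H c T x) = T x"
proof (rule vec_eqI)
  note Lb = L_bounded
  note [simp] = bounded_op_mem[OF positive_op_bounded[OF T]] bounded_op_mem[OF Lb]
  fix z assume z [simp]: "z \<in> carrier H"
  have sq: "complex_of_real (sqrt c) * complex_of_real (sqrt c) = of_real c"
    using c(1) by (simp flip: of_real_mult)
  have "cinner H (pos_root H c T (pos_root H c T x)) z =
      (complex_of_real (sqrt c) * complex_of_real (sqrt c)) *
        (cinner H x z - 2 * cinner H (L x) z + cinner H (L (L x)) z)"
    by (simp add: pos_root_def cinner_simps bounded_op_add[OF Lb] bounded_op_smult[OF Lb] algebra_simps)
  \<comment> \<open>The fixed point equation turns \<open>1 - 2 L + L\<^sup>2\<close> into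
    \<open>1 - D\<close>, which is \<open>T / c\<close>.\<close>
  also have "\<dots> = of_real c * (cinner H x z - cinner H (complement_op H c T x) z)"
    unfolding sq L_fixpoint[OF x z] by simp
  also have "\<dots> = cinner H (T x) z"
    using c(1) by (simp add: complement_op_def cinner_simps)
  finally show "cinner H (pos_root H c T (pos_root H c T x)) z = cinner H (T x) z" .
next
  show "pos_root H c T (pos_root H c T x) \<in> carrier H"
    using bounded_op_mem[OF positive_op_bounded[OF positive_op_pos_root]] by simp
  show "T x \<in> carrier H"
    using bounded_op_mem[OF positive_op_bounded[OF T]] by simp
qed

end

text \<open>One constant \<open>c\<close> serves both spaces, so that \<open>V\<close> intertwines
  \<open>1 - T / c\<close> with \<open>1 - T' / c\<close> and hence the two iterations.\<close>

lemma pos_root_intertwine: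
  assumes V: "V \<in> bounded_op H K" and HK: "chilbert H" "chilbert K"
    and T: "positive_op H T" "positive_op K T'" and c: "0 < c"
    "\<And>x. x \<in> carrier H \<Longrightarrow> cnorm H (T x) \<le> c * cnorm H x"
    "\<And>x. x \<in> carrier K \<Longrightarrow> cnorm K (T' x) \<le> c * cnorm K x"
    and VT: "\<And>x. x \<in> carrier H \<Longrightarrow> V (T x) = T' (V x)"
    and x: "x \<in> carrier H"
  shows "V (pos_root H c T x) = pos_root K c T' (V x)"
proof -
  interpret H: positive_contraction H "complement_op H c T"
    by (rule positive_contraction_complement_op[OF HK(1) T(1) c(1,2)])
  interpret K: positive_contraction K "complement_op K c T'"
    by (rule positive_contraction_complement_op[OF HK(2) T(2) c(1,3)])
  note V_simps = bounded_op_mem[OF V] bounded_op_add[OF V] bounded_op_smult[OF V]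
    bounded_op_mem[OF positive_op_bounded[OF T(1)]]
  have "V (sqrt_lim H (complement_op H c T) x) = sqrt_lim K (complement_op K c T') (V x)"
    by (rule sqrt_lim_intertwine[OF V H.positive_contraction_axioms K.positive_contraction_axioms _ x])
      (simp add: complement_op_def V_simps VT)
  then show ?thesis
    using x by (simp add: pos_root_def V_simps)
qed

lemma positive_op_bound:
  assumes "chilbert H" "positive_op H T"
  obtains c where "0 < c" "\<And>x. x \<in> carrier H \<Longrightarrow> cnorm H (T x) \<le> c * cnorm H x"
proof -
  interpret chilbert H by fact
  obtain c where c: "0 \<le> c" "\<And>x. x \<in> carrier H \<Longrightarrow> cnorm H (T x) \<le> c * cnorm H x"
    by (rule bounded_op_bound[OF positive_op_bounded[OF assms(2)] assms(1)]) blast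
  show thesis
  proof (rule that[of "c + 1"])
    fix x assume x: "x \<in> carrier H"
    show "cnorm H (T x) \<le> (c + 1) * cnorm H x"
      using c(2)[OF x] cnorm_nonneg[OF x] by (simp add: distrib_right)
  qed (use c in simp)
qed

text \<open>For \<open>v = (S - R) x\<close>, commutation gives
  \<open>(S + R) v = (S\<^sup>2 - R\<^sup>2) x = 0\<close>. Both forms are nonnegative at
  \<open>v\<close>, so \<open>S v = R v = 0\<close>, and
  \<open>cinner H v v = cinner H x ((S - R) v)\<close> vanishes.\<close>

lemma positive_sqrt_unique:
  assumes "chilbert H" "positive_op H S" "positive_op H R"
    and sq: "\<And>x. x \<in> carrier H \<Longrightarrow> S (S x) = R (R x)"
    and comm: "\<And>x. x \<in> carrier H \<Longrightarrow> S (R x) = R (S x)"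
    and x: "x \<in> carrier H"
  shows "S x = R x"
proof -
  interpret chilbert H by fact
  note Sb = positive_op_bounded[OF assms(2)] and Rb = positive_op_bounded[OF assms(3)]
  note [simp] = bounded_op_mem[OF Sb] bounded_op_mem[OF Rb]
  note Sd = bounded_op_diff[OF Sb assms(1,1)] and Rd = bounded_op_diff[OF Rb assms(1,1)]
  define v where "v = S x \<ominus>\<^bsub>H\<^esub> R x"
  have v [simp]: "v \<in> carrier H" using x by (simp add: v_def)
  have "cinner H (S v) v + cinner H (R v) v = 0"
  proof -
    have "cinner H (S v) z + cinner H (R v) z = 0" if "z \<in> carrier H" for z
      using x that by (simp add: v_def Sd Rd cinner_simps sq comm)
    then show ?thesis by simp
  qed
  then have "Re (cinner H (S v) v) + Re (cinner H (R v) v) = 0"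
    by (metis plus_complex.simps(1) zero_complex.simps(1))
  then have "Re (cinner H (S v) v) = 0" "Re (cinner H (R v) v) = 0"
    using positive_op_Re[OF assms(2) v] positive_op_Re[OF assms(3) v] by linarith+
  then have "S v = \<zero>\<^bsub>H\<^esub>" "R v = \<zero>\<^bsub>H\<^esub>"
    using positive_op_eq_zero assms(2,3) v by auto
  moreover have "cinner H v v = cinner H x (S v) - cinner H x (R v)"
    using x positive_op_selfadjoint[OF assms(2) x v] positive_op_selfadjoint[OF assms(3) x v]
      cinner_diff_left[of "S x" "R x" v] by (simp flip: v_def)
  ultimately have "cinner H v v = 0"
    using x by (simp add: cinner_zero_right)
  then have "v = \<zero>\<^bsub>H\<^esub>" by (intro cinner_definite) auto
  then show ?thesis
    using x eq_if_diff_eq_zero[of "S x" "R x"] by (simp add: v_def)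
qed

text \<open>A competing root \<open>S\<close> commutes with \<open>T = S\<^sup>2\<close>, hence with
  \<open>pos_root H c T\<close> by intertwining with \<open>V = S\<close>, and commuting positive
  roots agree. As the left side is free of \<open>c\<close>, any bound for \<open>T\<close> may be
  used.\<close>

lemma op_sqrt_eq_pos_root:
  assumes H: "chilbert H" and T: "positive_op H T" and c: "0 < c"
    "\<And>x. x \<in> carrier H \<Longrightarrow> cnorm H (T x) \<le> c * cnorm H x"
  shows "op_sqrt H T = pos_root H c T"
  unfolding op_sqrt_def
proof (rule the_equality)
  note root = positive_op_pos_root[OF H T c] and sq = pos_root_square[OF H T c]
  show "positive_op H (pos_root H c T) \<and> pos_root H c T \<in> extensional (carrier H) \<and>
      (\<forall>x\<in>carrier H. pos_root H c T (pos_root H c T x) = T x)"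
    using root sq by (simp add: pos_root_def)
  fix S assume S: "positive_op H S \<and> S \<in> extensional (carrier H) \<and> (\<forall>x\<in>carrier H. S (S x) = T x)"
  then have Sb: "S \<in> bounded_op H H" by (simp add: positive_op_def)
  have ST: "S (T x) = T (S x)" if "x \<in> carrier H" for x
    using S bounded_op_mem[OF Sb that] that by metis
  have comm: "S (pos_root H c T x) = pos_root H c T (S x)" if x: "x \<in> carrier H" for x
    by (rule pos_root_intertwine[OF Sb H H T T c(1) c(2) c(2) ST x])
  have "S x = pos_root H c T x" if "x \<in> carrier H" for x
    by (rule positive_sqrt_unique[where H = H and S = S and R = "pos_root H c T"])
      (use H S root sq comm that in auto)
  then show "S = pos_root H c T"
    using S by (intro extensionalityI[of _ "carrier H"]) (auto simp: pos_root_def)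
qed

lemma
  assumes "chilbert H" "positive_op H T"
  shows positive_op_op_sqrt: "positive_op H (op_sqrt H T)"
    and op_sqrt_square: "x \<in> carrier H \<Longrightarrow> op_sqrt H T (op_sqrt H T x) = T x"
proof -
  obtain c where c: "0 < c" "\<And>x. x \<in> carrier H \<Longrightarrow> cnorm H (T x) \<le> c * cnorm H x"
    using positive_op_bound[OF assms] by blast
  have eq: "op_sqrt H T = pos_root H c T" by (rule op_sqrt_eq_pos_root[OF assms c])
  show "positive_op H (op_sqrt H T)" "x \<in> carrier H \<Longrightarrow> op_sqrt H T (op_sqrt H T x) = T x"
    unfolding eq using positive_op_pos_root[OF assms c] pos_root_square[OF assms c] by auto
qed

lemma op_sqrt_intertwine:
  assumes V: "V \<in> bounded_op H K" and HK: "chilbert H" "chilbert K"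
    and T: "positive_op H T" "positive_op K T'"
    and VT: "\<And>x. x \<in> carrier H \<Longrightarrow> V (T x) = T' (V x)"
    and x: "x \<in> carrier H"
  shows "V (op_sqrt H T x) = op_sqrt K T' (V x)"
proof -
  interpret H: chilbert H by fact
  interpret K: chilbert K by fact
  obtain c where c: "0 < c" "\<And>x. x \<in> carrier H \<Longrightarrow> cnorm H (T x) \<le> c * cnorm H x"
    using positive_op_bound[OF HK(1) T(1)] by blast
  obtain d where d: "0 < d" "\<And>x. x \<in> carrier K \<Longrightarrow> cnorm K (T' x) \<le> d * cnorm K x"
    using positive_op_bound[OF HK(2) T(2)] by blast
  \<comment> \<open>A common bound, since the roots on the two spaces can be compared only for equal
    constants.\<close>
  have m: "0 < max c d" "\<And>x. x \<in> carrier H \<Longrightarrow> cnorm H (T x) \<le> max c d * cnorm H x"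
    "\<And>x. x \<in> carrier K \<Longrightarrow> cnorm K (T' x) \<le> max c d * cnorm K x"
  proof -
    fix x assume x: "x \<in> carrier H"
    show "cnorm H (T x) \<le> max c d * cnorm H x"
      using c(2)[OF x] mult_right_mono[of c "max c d" "cnorm H x"] x by simp
  next
    fix x assume x: "x \<in> carrier K"
    show "cnorm K (T' x) \<le> max c d * cnorm K x"
      using d(2)[OF x] mult_right_mono[of d "max c d" "cnorm K x"] x by simp
  qed (use c(1) in simp)
  have "op_sqrt H T = pos_root H (max c d) T"
    by (rule op_sqrt_eq_pos_root[OF HK(1) T(1) m(1,2)])
  moreover have "op_sqrt K T' = pos_root K (max c d) T'"
    by (rule op_sqrt_eq_pos_root[OF HK(2) T(2) m(1,3)])
  moreover have "V (pos_root H (max c d) T x) = pos_root K (max c d) T' (V x)"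
    by (rule pos_root_intertwine[OF V HK T m VT x])
  ultimately show ?thesis by simp
qed

section \<open>The mixed Schwarz inequality\<close>

lemma op_sqrt_cong: "(\<And>x. x \<in> carrier H \<Longrightarrow> T x = T' x) \<Longrightarrow> op_sqrt H T = op_sqrt H T'"
  by (simp add: op_sqrt_def)

lemma op_abs_cong:
  assumes "\<And>x. x \<in> carrier H \<Longrightarrow> T x = T' x"
  shows "op_abs H K T = op_abs H K T'"
proof -
  have "adj H K T = adj H K T'" by (rule adj_cong) (rule assms)
  then show ?thesis unfolding op_abs_def by (intro op_sqrt_cong) (simp add: assms)
qed

context
  fixes H :: "('a, 'm) cinner_space_scheme" and K :: "('b, 'k) cinner_space_scheme" and T :: "'a \<Rightarrow> 'b"
  assumes T: "T \<in> bounded_op H K" and HK: "chilbert H" "chilbert K"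
begin

interpretation H: chilbert H by (rule HK)
interpretation K: chilbert K by (rule HK)

lemmas T_mem [simp] = bounded_op_mem[OF T]

lemma positive_op_op_abs: "positive_op H (op_abs H K T)"
  unfolding op_abs_def by (intro positive_op_op_sqrt HK positive_op_adj_comp T)

lemmas abs_mem [simp] = bounded_op_mem[OF positive_op_bounded[OF positive_op_op_abs]]

lemma op_abs_square: "x \<in> carrier H \<Longrightarrow> op_abs H K T (op_abs H K T x) = adj H K T (T x)"
  unfolding op_abs_def using op_sqrt_square[OF HK(1) positive_op_adj_comp[OF T HK]] by simp

lemma cinner_op_abs:
  assumes x: "x \<in> carrier H" "y \<in> carrier H"
  shows "cinner H (op_abs H K T x) (op_abs H K T y) = cinner K (T x) (T y)"
proof -
  have "cinner H (op_abs H K T x) (op_abs H K T y) = cinner H x (op_abs H K T (op_abs H K T y))"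
    using x by (intro H.positive_op_selfadjoint positive_op_op_abs) auto
  then show ?thesis
    using x by (simp add: op_abs_square cinner_adj[OF T HK])
qed

lemma cnorm_op_abs: "x \<in> carrier H \<Longrightarrow> cnorm H (op_abs H K T x) = cnorm K (T x)"
  by (simp add: cnorm_def cinner_op_abs)

text \<open>With \<open>T'\<close> the adjoint of \<open>T\<close>, the product
  \<open>T T' T\<close> can be read as \<open>T\<close> after \<open>T' T\<close> or as
  \<open>T T'\<close> after \<open>T\<close>; passing to the roots of \<open>T' T\<close> and
  \<open>T T'\<close> gives the claim.\<close>

lemma op_abs_intertwine:
  assumes x: "x \<in> carrier H"
  shows "T (op_abs H K T x) = op_abs K H (adj H K T) (T x)"
  unfolding op_abs_def
proof (rule op_sqrt_intertwine[OF T HK positive_op_adj_comp[OF T HK] _ _ x])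
  show "positive_op K (adj K H (adj H K T) \<circ> adj H K T)"
    by (intro positive_op_adj_comp adj_bounded_op T HK)
  fix x assume "x \<in> carrier H"
  then show "T ((adj H K T \<circ> T) x) = (adj K H (adj H K T) \<circ> adj H K T) (T x)"
    using bounded_op_mem[OF adj_bounded_op[OF T HK]] by (simp add: adj_adj[OF T HK])
qed

end

text \<open>The form of \<open>S + e\<close> is at least \<open>e\<close> times the squared norm.
  This makes \<open>S + e\<close> bounded below by \<open>e\<close>, and a vector orthogonal to its
  range must vanish.\<close>

lemma ex_positive_op_shift_preimage:
  assumes "chilbert H" "positive_op H S" "0 < e" "x \<in> carrier H"
  shows "\<exists>u\<in>carrier H. S u \<oplus>\<^bsub>H\<^esub> complex_of_real e \<odot>\<^bsub>H\<^esub> u = x"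
proof -
  interpret chilbert H by fact
  note Sb = positive_op_bounded[OF assms(2)]
  note [simp] = bounded_op_mem[OF Sb]
  have ge: "e * (cnorm H u)\<^sup>2 \<le> Re (cinner H (S u \<oplus>\<^bsub>H\<^esub> complex_of_real e \<odot>\<^bsub>H\<^esub> u) u)"
    if u: "u \<in> carrier H" for u
    using u positive_op_Re[OF assms(2) u] by (simp add: cinner_simps cnorm_sq)
  show ?thesis
  proof (rule surj_if_bounded_below[OF _ assms(1,1,3)])
    show "(\<lambda>u. S u \<oplus>\<^bsub>H\<^esub> complex_of_real e \<odot>\<^bsub>H\<^esub> u) \<in> bounded_op H H"
      by (intro bounded_op_op_add bounded_op_op_scale bounded_op_id Sb assms(1))
    fix u assume u: "u \<in> carrier H"
    have "Re (cinner H (S u \<oplus>\<^bsub>H\<^esub> complex_of_real e \<odot>\<^bsub>H\<^esub> u) u)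
        \<le> cnorm H (S u \<oplus>\<^bsub>H\<^esub> complex_of_real e \<odot>\<^bsub>H\<^esub> u) * cnorm H u"
      using Cauchy_Schwarz[of "S u \<oplus>\<^bsub>H\<^esub> complex_of_real e \<odot>\<^bsub>H\<^esub> u" u] u
        complex_Re_le_cmod order_trans by fastforce
    then have *: "e * cnorm H u * cnorm H u \<le> cnorm H (S u \<oplus>\<^bsub>H\<^esub> complex_of_real e \<odot>\<^bsub>H\<^esub> u) * cnorm H u"
      using ge[OF u] by (simp add: power2_eq_square)
    show "e * cnorm H u \<le> cnorm H (S u \<oplus>\<^bsub>H\<^esub> complex_of_real e \<odot>\<^bsub>H\<^esub> u)"
    proof (cases "cnorm H u = 0")
      case True
      then show ?thesis using u by simp
    next
      case False
      then show ?thesis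
        using mult_right_le_imp_le[OF *] cnorm_nonneg[OF u] by linarith
    qed
  next
    fix y assume y: "y \<in> carrier H"
      and orth: "\<And>h. h \<in> carrier H \<Longrightarrow> cinner H (S h \<oplus>\<^bsub>H\<^esub> complex_of_real e \<odot>\<^bsub>H\<^esub> h) y = 0"
    have "e * (cnorm H y)\<^sup>2 \<le> 0"
      using ge[OF y] orth[OF y] by simp
    then have "cnorm H y = 0"
      using assms(3) by (simp add: mult_le_0_iff)
    then show "y = \<zero>\<^bsub>H\<^esub>" using y by (simp add: cnorm_eq_0)
  qed (use assms in auto)
qed

lemma le_if_le_add_mult:
  fixes a b k :: real
  assumes "0 \<le> k" "\<And>d. 0 < d \<Longrightarrow> a \<le> b + d * k"
  shows "a \<le> b"
proof (rule field_le_epsilon)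
  fix e :: real assume "0 < e"
  \<comment> \<open>The divisor \<open>k + 1\<close> also covers \<open>k = 0\<close>.\<close>
  then have "a \<le> b + e / (k + 1) * k"
    using assms by (intro assms(2)) auto
  also have "e / (k + 1) * k \<le> e"
    using assms(1) \<open>0 < e\<close> by (simp add: field_simps)
  finally show "a \<le> b + e" by simp
qed

text \<open>With \<open>S = |T|\<close>, \<open>S' = |T\<^sup>*|\<close> and \<open>x = (S + e) u\<close>, the relation \<open>T S = S' T\<close> gives
  \<open>\<langle>T x, y\<rangle> = \<langle>S' T u, y\<rangle> + e \<langle>T u, y\<rangle>\<close>. Cauchy--Schwarz for \<open>S'\<close> bounds the first summand, and the
  second one is of order \<open>sqrt e\<close>.\<close>

lemma mixed_Schwarz:
  assumes T: "T \<in> bounded_op H K" and HK: "chilbert H" "chilbert K"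
    and x: "x \<in> carrier H" and y: "y \<in> carrier K"
  shows "(cmod (cinner K (T x) y))\<^sup>2 \<le>
    Re (cinner H (op_abs H K T x) x) * Re (cinner K (op_abs K H (adj H K T) y) y)"
proof -
  interpret H: chilbert H by (rule HK)
  interpret K: chilbert K by (rule HK)
  define S where "S = op_abs H K T"
  define S' where "S' = op_abs K H (adj H K T)"
  have S: "positive_op H S" unfolding S_def by (rule positive_op_op_abs[OF T HK])
  have S': "positive_op K S'"
    unfolding S'_def by (rule positive_op_op_abs[OF adj_bounded_op[OF T HK] HK(2,1)])
  note Sb = positive_op_bounded[OF S] and S'b = positive_op_bounded[OF S']
  note [simp] = x y bounded_op_mem[OF Sb] bounded_op_mem[OF S'b] bounded_op_mem[OF T]
  obtain c where c: "0 < c" "\<And>x. x \<in> carrier H \<Longrightarrow> cnorm H (S x) \<le> c * cnorm H x"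
    using positive_op_bound[OF HK(1) S] by blast
  define p where "p = Re (cinner H (S x) x)"
  define q where "q = Re (cinner K (S' y) y)"
  have pq: "0 \<le> p" "0 \<le> q"
    unfolding p_def q_def by (auto intro!: positive_op_Re[OF S] positive_op_Re[OF S'])
  have "cmod (cinner K (T x) y) \<le> sqrt (p * q) + d * (c * cnorm H x * cnorm K y)" if d: "0 < d" for d
  proof -
    \<comment> \<open>The remainder turns out to be of size \<open>sqrt (c * e)\<close>; this
      \<open>e\<close> makes it \<open>c * d\<close>, linear in \<open>d\<close>.\<close>
    define e where "e = c * d\<^sup>2"
    have e: "0 < e" using c d by (simp add: e_def)
    obtain u where u [simp]: "u \<in> carrier H" and xu: "S u \<oplus>\<^bsub>H\<^esub> complex_of_real e \<odot>\<^bsub>H\<^esub> u = x"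
      using ex_positive_op_shift_preimage[OF HK(1) S e x] by blast
    define n where "n = Re (cinner H (S u) u)"
    have n: "0 \<le> n" unfolding n_def by (rule positive_op_Re[OF S u])
    have "T x = T (S u) \<oplus>\<^bsub>K\<^esub> complex_of_real e \<odot>\<^bsub>K\<^esub> T u"
      by (simp add: bounded_op_add[OF T] bounded_op_smult[OF T] flip: xu)
    moreover have TS: "T (S u) = S' (T u)"
      unfolding S_def S'_def by (rule op_abs_intertwine[OF T HK u])
    ultimately have "cinner K (T x) y = cinner K (S' (T u)) y + of_real e * cinner K (T u) y"
      by (simp add: K.cinner_simps)
    then have "cmod (cinner K (T x) y) \<le> cmod (cinner K (S' (T u)) y) + e * cmod (cinner K (T u) y)"
      using norm_triangle_ineq[of "cinner K (S' (T u)) y" "of_real e * cinner K (T u) y"] e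
      by (simp add: norm_mult)
    moreover have "cmod (cinner K (S' (T u)) y) \<le> sqrt (p * q)"
    proof -
      have "cinner K (S' (T u)) (T u) = cinner H (S (S u)) (S u)"
        unfolding TS[symmetric] unfolding S_def by (rule cinner_op_abs[OF T HK, symmetric]) (simp_all flip: S_def)
      \<comment> \<open>Expanding \<open>cinner H (S x) x\<close> with \<open>x = S u + e u\<close>
        produces this term and two nonnegative ones, which are dropped. The bound no longer depends
        on \<open>u\<close>.\<close>
      moreover have "Re (cinner H (S (S u)) (S u)) \<le> p"
      proof -
        have "cinner H (S (S u)) u = cinner H (S u) (S u)"
          by (rule H.positive_op_selfadjoint[OF S]) auto
        then have "p = Re (cinner H (S (S u)) (S u)) + 2 * e * Re (cinner H (S u) (S u)) + e\<^sup>2 * n"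
          unfolding p_def n_def
          by (simp add: bounded_op_add[OF Sb] bounded_op_smult[OF Sb] H.cinner_simps
              power2_eq_square algebra_simps flip: xu)
        then show ?thesis using e n H.cinner_nonneg[of "S u"] by simp
      qed
      ultimately have "(cmod (cinner K (S' (T u)) y))\<^sup>2 \<le> p * q"
        using K.positive_op_Cauchy_Schwarz[OF S', of "T u" y] pq
        by (smt (verit) T_mem q_def HK T mult_right_mono u y)
      then show ?thesis by (rule real_le_rsqrt)
    qed
    moreover have "e * cmod (cinner K (T u) y) \<le> d * (c * cnorm H x * cnorm K y)"
    proof -
      \<comment> \<open>The norm of \<open>u\<close> may blow up as \<open>e\<close> tends to
        \<open>0\<close>, so it is the norm of \<open>S u\<close>, equal to that of
        \<open>T u\<close>, that gets estimated: its square is at most \<open>c * n\<close>, while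
        \<open>e * n\<close> is at most the squared norm of \<open>x\<close>.\<close>
      have "(cnorm H x)\<^sup>2 = (cnorm H (S u))\<^sup>2 + 2 * (e * n) + e\<^sup>2 * (cnorm H u)\<^sup>2"
        using e by (simp add: n_def H.cnorm_sq_add H.cnorm_smult H.cinner_simps power_mult_distrib flip: xu)
      then have en: "e * n \<le> (cnorm H x)\<^sup>2"
        using e n by (smt (verit) mult_nonneg_nonneg zero_le_power2)
      have "((cnorm H (S u))\<^sup>2)\<^sup>2 \<le> n * Re (cinner H (S (S u)) (S u))"
        using H.positive_op_Cauchy_Schwarz[OF S, of u "S u"]
        by (simp add: n_def H.cinner_self[of "S u"] norm_power)
      also have "\<dots> \<le> n * (c * (cnorm H (S u))\<^sup>2)"
      proof (rule mult_left_mono[OF _ n])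
        have "Re (cinner H (S (S u)) (S u)) \<le> cnorm H (S (S u)) * cnorm H (S u)"
          using H.Cauchy_Schwarz[of "S (S u)" "S u"] complex_Re_le_cmod order_trans by fastforce
        also have "\<dots> \<le> c * cnorm H (S u) * cnorm H (S u)"
          using c(2)[of "S u"] by (intro mult_right_mono) auto
        finally show "Re (cinner H (S (S u)) (S u)) \<le> c * (cnorm H (S u))\<^sup>2"
          by (simp add: power2_eq_square)
      qed
      finally have *: "(cnorm H (S u))\<^sup>2 * (cnorm H (S u))\<^sup>2 \<le> (c * n) * (cnorm H (S u))\<^sup>2"
        by (simp add: power2_eq_square mult_ac)
      have Su: "(cnorm H (S u))\<^sup>2 \<le> c * n"
      proof (cases "cnorm H (S u) = 0")
        case True
        then show ?thesis using c n by simp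
      next
        case False
        then show ?thesis using mult_right_le_imp_le[OF *] by simp
      qed
      have "(e * cnorm H (S u))\<^sup>2 \<le> e\<^sup>2 * (c * n)"
        using mult_left_mono[OF Su, of "e\<^sup>2"] by (simp add: power_mult_distrib)
      also have "\<dots> = e * c * (e * n)" by (simp add: power2_eq_square)
      also have "\<dots> \<le> e * c * (cnorm H x)\<^sup>2"
        using en e c by (intro mult_left_mono) auto
      also have "\<dots> = (d * c * cnorm H x)\<^sup>2"
        by (simp add: e_def power2_eq_square)
      finally have "e * cnorm H (S u) \<le> d * c * cnorm H x"
        using d c by (rule_tac power2_le_imp_le) auto
      then have "e * cnorm K (T u) \<le> d * c * cnorm H x"
        unfolding S_def by (simp add: cnorm_op_abs[OF T HK])
      then have "e * cnorm K (T u) * cnorm K y \<le> d * c * cnorm H x * cnorm K y"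
        by (intro mult_right_mono) auto
      moreover have "e * cmod (cinner K (T u) y) \<le> e * (cnorm K (T u) * cnorm K y)"
        using e by (intro mult_left_mono K.Cauchy_Schwarz) auto
      ultimately show ?thesis by (simp add: mult.assoc)
    qed
    ultimately show ?thesis by linarith
  qed
  then have "cmod (cinner K (T x) y) \<le> sqrt (p * q)"
    by (rule le_if_le_add_mult[where k = "c * cnorm H x * cnorm K y", rotated])
      (use c(1) in \<open>auto intro!: mult_nonneg_nonneg\<close>)
  then have "(cmod (cinner K (T x) y))\<^sup>2 \<le> (sqrt (p * q))\<^sup>2"
    by (intro power_mono) auto
  then show ?thesis
    using pq by (simp add: p_def q_def S_def S'_def)
qed

text \<open>The vector \<open>w\<close> is \<open>k\<close> times the reflection of \<open>a\<close>
  in the line spanned by \<open>e\<close>, so its norm is \<open>k\<close> times that of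
  \<open>a\<close>. Cauchy-Schwarz for \<open>w\<close> and \<open>b\<close> then suffices; scaling
  by \<open>k\<close> avoids dividing by the norm of \<open>e\<close>.\<close>

lemma (in chilbert) Buzano:
  assumes [simp]: "a \<in> carrier H" "b \<in> carrier H" "e \<in> carrier H"
  shows "2 * cmod (cinner H a e * cinner H e b) \<le> (cnorm H a * cnorm H b + cmod (cinner H a b)) * (cnorm H e)\<^sup>2"
proof -
  define k where "k = (cnorm H e)\<^sup>2"
  define w where "w = (2 * cinner H a e) \<odot> e \<ominus> complex_of_real k \<odot> a"
  have w [simp]: "w \<in> carrier H" by (simp add: w_def)
  have "Re (cinner H a e * cinner H e a) = (cmod (cinner H a e))\<^sup>2"
    unfolding cmod_power2 using cinner_commute[of e a] by (simp add: power2_eq_square)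
  then have "(cnorm H w)\<^sup>2 = (k * cnorm H a)\<^sup>2"
    unfolding w_def
    by (simp add: cnorm_sq_diff cnorm_smult cinner_simps norm_mult power_mult_distrib)
      (simp add: k_def power2_eq_square algebra_simps)
  then have nw: "cnorm H w = k * cnorm H a"
    by (simp add: power2_eq_iff_nonneg k_def)
  have "2 * (cinner H a e * cinner H e b) = cinner H w b + of_real k * cinner H a b"
    by (simp add: w_def cinner_simps)
  then have "cmod (2 * (cinner H a e * cinner H e b)) \<le> cmod (cinner H w b) + k * cmod (cinner H a b)"
    using norm_triangle_ineq[of "cinner H w b" "of_real k * cinner H a b"]
    by (simp add: norm_mult norm_power k_def)
  also have "cmod (cinner H w b) \<le> k * cnorm H a * cnorm H b"
    using Cauchy_Schwarz[of w b] by (simp add: nw)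
  finally show ?thesis
    by (simp add: norm_mult k_def algebra_simps)
qed

section \<open>Numerical radius\<close>

context chilbert
begin

lemma bdd_above_numerical_range:
  assumes "T \<in> bounded_op H H"
  shows "bdd_above (insert 0 {cmod (cinner H (T x) x) | x. x \<in> carrier H \<and> cnorm H x = 1})"
proof -
  obtain c where c: "0 \<le> c" "\<And>x. x \<in> carrier H \<Longrightarrow> cnorm H (T x) \<le> c * cnorm H x"
    using bounded_op_bound[OF assms chilbert_axioms] by blast
  have "cmod (cinner H (T x) x) \<le> c" if "x \<in> carrier H" "cnorm H x = 1" for x
    using Cauchy_Schwarz[of "T x" x] c(2)[of x] that bounded_op_mem[OF assms] by fastforce
  then show ?thesis
    using c(1) by (intro bdd_aboveI[of _ c]) auto
qed

lemma numerical_radius_nonneg: "T \<in> bounded_op H H \<Longrightarrow> 0 \<le> numerical_radius H T"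
  unfolding numerical_radius_def by (rule cSup_upper[OF _ bdd_above_numerical_range]) auto

lemma normalize:
  assumes "x \<in> carrier H" "cnorm H x \<noteq> 0"
  obtains u where "u \<in> carrier H" "cnorm H u = 1" "x = complex_of_real (cnorm H x) \<odot> u"
proof
  show "complex_of_real (1 / cnorm H x) \<odot> x \<in> carrier H" using assms by simp
  show "cnorm H (complex_of_real (1 / cnorm H x) \<odot> x) = 1"
    unfolding cnorm_smult[OF assms(1)] norm_of_real using assms by simp
  show "x = complex_of_real (cnorm H x) \<odot> (complex_of_real (1 / cnorm H x) \<odot> x)"
    using assms by (intro vec_eqI) (auto simp: cinner_simps)
qed

lemma cmod_le_numerical_radius:
  assumes T: "T \<in> bounded_op H H" and x: "x \<in> carrier H"
  shows "cmod (cinner H (T x) x) \<le> numerical_radius H T * (cnorm H x)\<^sup>2"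
proof (cases "cnorm H x = 0")
  case True
  then have "x = \<zero>\<^bsub>H\<^esub>" using x cnorm_eq_0 by blast
  then show ?thesis
    using bounded_op_mem[OF T] by (simp add: cinner_zero_right)
next
  case False
  then obtain u where u [simp]: "u \<in> carrier H" "cnorm H u = 1" and xu: "x = complex_of_real (cnorm H x) \<odot> u"
    using normalize[OF x] by blast
  have "cmod (cinner H (T u) u) \<le> numerical_radius H T"
    unfolding numerical_radius_def by (rule cSup_upper[OF _ bdd_above_numerical_range[OF T]]) auto
  moreover have "cmod (cinner H (T x) x) = (cnorm H x)\<^sup>2 * cmod (cinner H (T u) u)"
    by (subst (1 2) xu) (use x bounded_op_mem[OF T] in
      \<open>simp add: bounded_op_smult[OF T] cinner_simps norm_mult power2_eq_square\<close>)
  ultimately show ?thesis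
    using mult_left_mono[of "cmod (cinner H (T u) u)" "numerical_radius H T" "(cnorm H x)\<^sup>2"]
    by (simp add: mult.commute)
qed

lemma cnorm_le_op_norm:
  assumes T: "T \<in> bounded_op H H" and x: "x \<in> carrier H"
  shows "cnorm H (T x) \<le> op_norm H H T * cnorm H x"
proof (cases "cnorm H x = 0")
  case True
  obtain c where "cnorm H (T x) \<le> c * cnorm H x"
    using bounded_op_bound[OF T chilbert_axioms] x by blast
  then show ?thesis using True by simp
next
  case False
  then obtain u where u [simp]: "u \<in> carrier H" "cnorm H u = 1" and xu: "x = complex_of_real (cnorm H x) \<odot> u"
    using normalize[OF x] by blast
  obtain c where c: "0 \<le> c" "\<And>x. x \<in> carrier H \<Longrightarrow> cnorm H (T x) \<le> c * cnorm H x"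
    using bounded_op_bound[OF T chilbert_axioms] by blast
  have "cnorm H (T x) \<le> c" if "x \<in> carrier H" "cnorm H x \<le> 1" for x
    using c(2)[OF that(1)] mult_left_mono[OF that(2) c(1)] by simp
  then have "bdd_above {cnorm H (T x) | x. x \<in> carrier H \<and> cnorm H x \<le> 1}"
    by (intro bdd_aboveI[of _ c]) auto
  then have "cnorm H (T u) \<le> op_norm H H T"
    unfolding op_norm_def by (rule cSup_upper[rotated]) (auto intro!: exI[of _ u])
  moreover have "cnorm H (T x) = cnorm H x * cnorm H (T u)"
    by (subst (1) xu) (use x bounded_op_mem[OF T] in \<open>simp add: bounded_op_smult[OF T] cnorm_smult\<close>)
  ultimately show ?thesis
    using mult_left_mono[of "cnorm H (T u)" "op_norm H H T" "cnorm H x"] x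
    by (simp add: mult.commute)
qed

end

text \<open>The last two terms live on \<open>H\<close> alone because Buzano's inequality is used
  with \<open>y\<close> as the middle vector. This is the source of the asymmetry of
  \<open>lam\<close> in its two indices.\<close>

lemma off_diagonal_bound:
  assumes V: "V \<in> bounded_op H K" and W: "W \<in> bounded_op K H" and HK: "chilbert H" "chilbert K"
    and x: "x \<in> carrier H" and y: "y \<in> carrier K"
  defines "P \<equiv> op_abs H K V" and "Q \<equiv> op_abs H K (adj K H W)"
    and "R \<equiv> op_abs K H (adj H K V)" and "S \<equiv> op_abs K H W"
  shows "(cmod (cinner K (V x) y) + cmod (cinner H (W y) x))\<^sup>2 \<le>
    (numerical_radius H (op_add H P (op_scale H \<i> Q)) * numerical_radius K (op_add K R (op_scale K \<i> S)) +
     1 / 2 * op_norm H H (op_add H (P \<circ> P) (Q \<circ> Q)) + numerical_radius H (W \<circ> V)) *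
      ((cnorm H x)\<^sup>2 * (cnorm K y)\<^sup>2)"
proof -
  interpret H: chilbert H by (rule HK)
  interpret K: chilbert K by (rule HK)
  note V' = adj_bounded_op[OF V HK] and W' = adj_bounded_op[OF W HK(2,1)]
  have P: "positive_op H P" and Q: "positive_op H Q" and R: "positive_op K R" and S: "positive_op K S"
    unfolding P_def Q_def R_def S_def
    by (rule positive_op_op_abs[OF _ HK] positive_op_op_abs[OF _ HK(2,1)]; rule V W V' W')+
  note b = positive_op_bounded[OF P] positive_op_bounded[OF Q] positive_op_bounded[OF R] positive_op_bounded[OF S]
  note [simp] = x y bounded_op_mem[OF V] bounded_op_mem[OF W] bounded_op_mem[OF V'] bounded_op_mem[OF W']
    b[THEN bounded_op_mem]
  define p q r s where "p = Re (cinner H (P x) x)" and "q = Re (cinner H (Q x) x)"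
    and "r = Re (cinner K (R y) y)" and "s = Re (cinner K (S y) y)"
  define a b where "a = cmod (cinner K (V x) y)" and "b = cmod (cinner H (W y) x)"
  let ?w1 = "numerical_radius H (op_add H P (op_scale H \<i> Q))"
  let ?w2 = "numerical_radius K (op_add K R (op_scale K \<i> S))"
  let ?N = "op_norm H H (op_add H (P \<circ> P) (Q \<circ> Q))"
  have PQ: "op_add H P (op_scale H \<i> Q) \<in> bounded_op H H"
    and RS: "op_add K R (op_scale K \<i> S) \<in> bounded_op K K"
    unfolding op_add_def op_scale_def
    by (intro bounded_op_op_add bounded_op_op_scale b HK)+
  have PPQQ: "op_add H (P \<circ> P) (Q \<circ> Q) \<in> bounded_op H H"
    unfolding op_add_def by (intro bounded_op_op_add bounded_op_comp[where K = H] b HK)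
  have "a\<^sup>2 \<le> p * r"
    unfolding a_def p_def r_def P_def R_def by (rule mixed_Schwarz[OF V HK x y])
  moreover have "b\<^sup>2 \<le> s * q"
    unfolding b_def s_def q_def S_def Q_def by (rule mixed_Schwarz[OF W HK(2,1) y x])
  \<comment> \<open>Cauchy-Schwarz in the plane, with the pairs read as complex numbers. The forms
    of \<open>P\<close> and \<open>Q\<close> are real, so \<open>p + \<i> q\<close> is the form of
    \<open>P + \<i> Q\<close> at \<open>x\<close>: this is where the imaginary unit in
    \<open>lam\<close> comes from.\<close>
  moreover have "p * r + s * q \<le> cmod (Complex p q) * cmod (Complex r s)"
    using complex_Re_le_cmod[of "Complex p q * cnj (Complex r s)"] by (simp add: norm_mult mult.commute)
  moreover have "cinner H (op_add H P (op_scale H \<i> Q) x) x = Complex p q"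
    using positive_op_Im[OF P x] positive_op_Im[OF Q x]
    by (simp add: op_add_def op_scale_def H.cinner_simps p_def q_def complex_eq_iff)
  then have "cmod (Complex p q) \<le> ?w1 * (cnorm H x)\<^sup>2"
    using H.cmod_le_numerical_radius[OF PQ x] by simp
  moreover have "cinner K (op_add K R (op_scale K \<i> S) y) y = Complex r s"
    using positive_op_Im[OF R y] positive_op_Im[OF S y]
    by (simp add: op_add_def op_scale_def K.cinner_simps r_def s_def complex_eq_iff)
  then have "cmod (Complex r s) \<le> ?w2 * (cnorm K y)\<^sup>2"
    using K.cmod_le_numerical_radius[OF RS y] by simp
  ultimately have squares: "a\<^sup>2 + b\<^sup>2 \<le> (?w1 * (cnorm H x)\<^sup>2) * (?w2 * (cnorm K y)\<^sup>2)"
    using mult_mono[of "cmod (Complex p q)" "?w1 * (cnorm H x)\<^sup>2" "cmod (Complex r s)" "?w2 * (cnorm K y)\<^sup>2"]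
      H.numerical_radius_nonneg[OF PQ]
    by simp
  \<comment> \<open>Moving \<open>W\<close> to the other side brings \<open>y\<close> into both
    factors, the shape that Buzano's inequality requires.\<close>
  have "2 * (a * b) = 2 * cmod (cinner K (V x) y * cinner K y (adj K H W x))"
    using cinner_adj[OF W HK(2,1) y x] by (simp add: a_def b_def norm_mult)
  also have "\<dots> \<le> (cnorm K (V x) * cnorm K (adj K H W x) + cmod (cinner K (V x) (adj K H W x))) * (cnorm K y)\<^sup>2"
    by (rule K.Buzano) auto
  also have "\<dots> \<le> (1 / 2 * ?N * (cnorm H x)\<^sup>2 + numerical_radius H (W \<circ> V) * (cnorm H x)\<^sup>2) * (cnorm K y)\<^sup>2"
  proof (intro mult_right_mono add_mono)
    \<comment> \<open>The norms of \<open>V x\<close> and \<open>adj K H W x\<close> are those of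
      \<open>P x\<close> and \<open>Q x\<close>. The arithmetic-geometric mean inequality for their
      product gives half of the form of \<open>P\<^sup>2 + Q\<^sup>2\<close>, hence the constant
      \<open>1 / 2\<close>.\<close>
    have "Re (cinner H (op_add H (P \<circ> P) (Q \<circ> Q) x) x) = (cnorm H (P x))\<^sup>2 + (cnorm H (Q x))\<^sup>2"
      using H.positive_op_selfadjoint[OF P, of "P x" x] H.positive_op_selfadjoint[OF Q, of "Q x" x]
      by (simp add: op_add_def H.cinner_simps H.cnorm_sq)
    moreover have "Re (cinner H (op_add H (P \<circ> P) (Q \<circ> Q) x) x) \<le> ?N * (cnorm H x)\<^sup>2"
    proof -
      have "Re (cinner H (op_add H (P \<circ> P) (Q \<circ> Q) x) x) \<le> cnorm H (op_add H (P \<circ> P) (Q \<circ> Q) x) * cnorm H x"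
        using H.Cauchy_Schwarz[of "op_add H (P \<circ> P) (Q \<circ> Q) x" x] bounded_op_mem[OF PPQQ x] x
          complex_Re_le_cmod order_trans by blast
      also have "\<dots> \<le> ?N * cnorm H x * cnorm H x"
        by (intro mult_right_mono H.cnorm_le_op_norm PPQQ) auto
      finally show ?thesis by (simp add: power2_eq_square)
    qed
    moreover have "cnorm H (P x) = cnorm K (V x)"
      unfolding P_def by (rule cnorm_op_abs[OF V HK x])
    moreover have "cnorm H (Q x) = cnorm K (adj K H W x)"
      unfolding Q_def by (rule cnorm_op_abs[OF W' HK x])
    ultimately show "cnorm K (V x) * cnorm K (adj K H W x) \<le> 1 / 2 * ?N * (cnorm H x)\<^sup>2"
      using sum_squares_bound[of "cnorm K (V x)" "cnorm K (adj K H W x)"] by simp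
    have "cinner K (V x) (adj K H W x) = cinner H ((W \<circ> V) x) x"
      using cinner_adj[OF W HK(2,1) _ x] by simp
    then show "cmod (cinner K (V x) (adj K H W x)) \<le> numerical_radius H (W \<circ> V) * (cnorm H x)\<^sup>2"
      using H.cmod_le_numerical_radius[OF bounded_op_comp[OF V W HK] x] by simp
  qed auto
  finally have "(a + b)\<^sup>2 \<le> (?w1 * (cnorm H x)\<^sup>2) * (?w2 * (cnorm K y)\<^sup>2) +
      (1 / 2 * ?N * (cnorm H x)\<^sup>2 + numerical_radius H (W \<circ> V) * (cnorm H x)\<^sup>2) * (cnorm K y)\<^sup>2"
    using squares by (simp add: power2_sum)
  then show ?thesis
    unfolding a_def b_def by (simp add: algebra_simps)
qed

section \<open>The numerical radius of a matrix\<close>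

lemma carrier_std_space: "carrier (std_space n) = carrier_vec n"
  and cinner_std_space: "cinner (std_space n) x y = x \<bullet>c y"
  by (simp_all add: std_space_def module.defs module_vec_def)

lemma scalar_prod_conjugate_eq:
  "\<lbrakk>x \<in> carrier_vec n; y \<in> carrier_vec n\<rbrakk> \<Longrightarrow> x \<bullet>c y = (\<Sum>i<n. x $ i * cnj (y $ i))" for x :: "complex vec"
  by (auto simp: scalar_prod_def atLeast0LessThan intro!: sum.cong)

lemma cnorm_std_space:
  "x \<in> carrier_vec n \<Longrightarrow> cnorm (std_space n) x = sqrt (\<Sum>i<n. (cmod (x $ i))\<^sup>2)"
  by (simp add: cnorm_def cinner_std_space scalar_prod_conjugate_eq complex_norm_square[symmetric])

lemma cinner_mult_mat_vec:
  assumes "M \<in> carrier_mat n n" "x \<in> carrier_vec n"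
  shows "cinner (std_space n) (M *\<^sub>v x) x = (\<Sum>i<n. \<Sum>j<n. M $$ (i, j) * x $ j * cnj (x $ i))"
proof -
  have "M *\<^sub>v x \<in> carrier_vec n" using assms by simp
  then show ?thesis
    using assms by (simp add: cinner_std_space scalar_prod_conjugate_eq)
      (auto simp: scalar_prod_def atLeast0LessThan sum_distrib_right intro!: sum.cong)
qed

text \<open>The bound is read off from the entries: each coordinate of a unit vector has modulus at
  most \<open>1\<close>. No Hilbert space structure on \<open>std_space n\<close> has to be
  established.\<close>

lemma bdd_above_mat_numerical_range:
  assumes M: "M \<in> carrier_mat n n"
  shows "bdd_above (insert 0 {cmod (cinner (std_space n) (M *\<^sub>v x) x) | x.
    x \<in> carrier (std_space n) \<and> cnorm (std_space n) x = 1})"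
proof -
  let ?C = "\<Sum>i<n. \<Sum>j<n. cmod (M $$ (i, j))"
  have "cmod (cinner (std_space n) (M *\<^sub>v x) x) \<le> ?C"
    if x: "x \<in> carrier_vec n" "cnorm (std_space n) x = 1" for x
  proof -
    have le1: "cmod (x $ i) \<le> 1" if "i < n" for i
    proof -
      have "(cmod (x $ i))\<^sup>2 \<le> (\<Sum>i<n. (cmod (x $ i))\<^sup>2)"
        using that by (intro member_le_sum) auto
      also have "\<dots> = 1" using x by (simp add: cnorm_std_space)
      finally show ?thesis by (simp add: abs_square_le_1)
    qed
    have "cmod (cinner (std_space n) (M *\<^sub>v x) x) \<le> (\<Sum>i<n. \<Sum>j<n. cmod (M $$ (i, j) * x $ j * cnj (x $ i)))"
      unfolding cinner_mult_mat_vec[OF M x(1)] by (intro order_trans[OF norm_sum] sum_mono norm_sum)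
    also have "\<dots> \<le> ?C"
    proof (intro sum_mono)
      fix i j assume "i \<in> {..<n}" "j \<in> {..<n}"
      then have "cmod (x $ j) * cmod (x $ i) \<le> 1" using le1 by (simp add: mult_le_one)
      then show "cmod (M $$ (i, j) * x $ j * cnj (x $ i)) \<le> cmod (M $$ (i, j))"
        using mult_left_mono[of "cmod (x $ j) * cmod (x $ i)" 1 "cmod (M $$ (i, j))"]
        by (simp add: norm_mult mult.assoc)
    qed
    finally show ?thesis .
  qed
  moreover have "0 \<le> ?C" by (intro sum_nonneg) auto
  ultimately show ?thesis
    by (intro bdd_aboveI[of _ ?C]) (auto simp: carrier_std_space)
qed

lemma mat_numerical_radius_nonneg: "M \<in> carrier_mat n n \<Longrightarrow> 0 \<le> mat_numerical_radius n M"
  unfolding mat_numerical_radius_def numerical_radius_def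
  by (rule cSup_upper[OF _ bdd_above_mat_numerical_range]) auto

text \<open>The normalised vector of the real numbers \<open>u i\<close> is one of the test vectors
  in the supremum; the form is real there, hence at most its modulus.\<close>

lemma real_quadratic_form_le_mat_numerical_radius:
  fixes m :: "nat \<Rightarrow> nat \<Rightarrow> real" and u :: "nat \<Rightarrow> real"
  shows "(\<Sum>i<n. \<Sum>j<n. m i j * u j * u i) \<le>
    mat_numerical_radius n (mat n n (\<lambda>(i, j). complex_of_real (m i j))) * (\<Sum>i<n. (u i)\<^sup>2)"
proof -
  let ?M = "mat n n (\<lambda>(i, j). complex_of_real (m i j))"
  let ?s = "\<Sum>i<n. (u i)\<^sup>2"
  have s: "0 \<le> ?s" by (intro sum_nonneg) auto
  show ?thesis
  proof (cases "?s = 0")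
    case True
    then have "u i = 0" if "i < n" for i
      using that by (simp add: sum_nonneg_eq_0_iff)
    then show ?thesis using True by simp
  next
    case False
    define x where "x = vec n (\<lambda>i. complex_of_real (u i / sqrt ?s))"
    have x: "x \<in> carrier_vec n" by (simp add: x_def)
    have M: "?M \<in> carrier_mat n n" by simp
    have "(\<Sum>i<n. (cmod (x $ i))\<^sup>2) = (\<Sum>i<n. (u i)\<^sup>2 / ?s)"
      using s by (intro sum.cong) (auto simp: x_def norm_divide power_divide)
    also have "\<dots> = 1" using False by (simp flip: sum_divide_distrib)
    finally have norm_x: "cnorm (std_space n) x = 1" by (simp add: cnorm_std_space[OF x])
    have "cinner (std_space n) (?M *\<^sub>v x) x = of_real ((\<Sum>i<n. \<Sum>j<n. m i j * u j * u i) / ?s)"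
    proof -
      have "sqrt ?s * sqrt ?s = ?s" using s by simp
      then have "m i j * (u j / sqrt ?s) * (u i / sqrt ?s) = m i j * u j * u i / ?s" for i j
        by simp
      then have "cinner (std_space n) (?M *\<^sub>v x) x = (\<Sum>i<n. \<Sum>j<n. of_real (m i j * u j * u i / ?s))"
        unfolding cinner_mult_mat_vec[OF M x]
        by (intro sum.cong refl) (simp add: x_def flip: of_real_mult of_real_divide)
      then show ?thesis by (simp only: of_real_sum sum_divide_distrib)
    qed
    then have "\<bar>(\<Sum>i<n. \<Sum>j<n. m i j * u j * u i) / ?s\<bar> = cmod (cinner (std_space n) (?M *\<^sub>v x) x)"
      by (simp only: norm_of_real)
    also have "\<dots> \<le> mat_numerical_radius n ?M"
      unfolding mat_numerical_radius_def numerical_radius_def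
      by (rule cSup_upper[OF _ bdd_above_mat_numerical_range[OF M]])
        (use x norm_x in \<open>auto simp: carrier_std_space\<close>)
    finally have "(\<Sum>i<n. \<Sum>j<n. m i j * u j * u i) / ?s \<le> mat_numerical_radius n ?M"
      by (rule abs_le_D1)
    then show ?thesis
      using s False by (simp add: divide_le_eq)
  qed
qed

section \<open>Sums of operators and inverses\<close>

lemma bounded_op_cong:
  assumes "T \<in> bounded_op H K" "chilbert H" "\<And>x. x \<in> carrier H \<Longrightarrow> T' x = T x"
  shows "T' \<in> bounded_op H K"
proof -
  interpret chilbert H by fact
  obtain c where "\<And>x. x \<in> carrier H \<Longrightarrow> cnorm K (T x) \<le> c * cnorm H x"
    using bounded_op_bound[OF assms(1,2)] by blast
  then show ?thesis
    using assms by (intro bounded_opI[where c = c])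
      (auto simp: bounded_op_mem bounded_op_add bounded_op_smult)
qed

lemma bounded_op_finsum:
  assumes "finite I" "\<And>i. i \<in> I \<Longrightarrow> T i \<in> bounded_op H K" "chilbert H" "chilbert K"
  shows "(\<lambda>x. \<Oplus>\<^bsub>K\<^esub>i\<in>I. T i x) \<in> bounded_op H K"
  using assms(1,2)
proof (induction I rule: finite_induct)
  case empty
  interpret H: chilbert H by fact
  interpret K: chilbert K by fact
  show ?case
    by (rule bounded_opI[where c = 0]) (auto intro!: K.vec_eqI simp: K.cinner_simps)
next
  case (insert i I)
  interpret H: chilbert H by fact
  interpret K: chilbert K by fact
  have "(\<lambda>x. T i x \<oplus>\<^bsub>K\<^esub> (\<Oplus>\<^bsub>K\<^esub>i\<in>I. T i x)) \<in> bounded_op H K"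
    using insert assms by (intro bounded_op_op_add) auto
  then show ?case
  proof (rule bounded_op_cong[OF _ assms(3)])
    fix x assume x: "x \<in> carrier H"
    have "T j x \<in> carrier K" if "j \<in> insert i I" for j
      using bounded_op_mem[OF insert.prems[OF that] x] .
    then have "(\<lambda>i. T i x) \<in> I \<rightarrow> carrier K" "T i x \<in> carrier K"
      by auto
    then show "(\<Oplus>\<^bsub>K\<^esub>i\<in>insert i I. T i x) = T i x \<oplus>\<^bsub>K\<^esub> (\<Oplus>\<^bsub>K\<^esub>i\<in>I. T i x)"
      using insert.hyps by simp
  qed
qed

text \<open>Moving \<open>T\<close> to the other argument as an adjoint leaves a finite sum in the
  first argument of an inner product, so additivity of \<open>T\<close> over finite sums needs no
  separate induction.\<close>

lemma cinner_bounded_op_finsum: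
  assumes "T \<in> bounded_op H K" "chilbert H" "chilbert K" "finite I"
    and f: "\<And>i. i \<in> I \<Longrightarrow> f i \<in> carrier H" and y: "y \<in> carrier K"
  shows "cinner K (T (\<Oplus>\<^bsub>H\<^esub>i\<in>I. f i)) y = (\<Sum>i\<in>I. cinner K (T (f i)) y)"
proof -
  interpret H: chilbert H by fact
  have z: "adj H K T y \<in> carrier H"
    using adj_bounded_op[OF assms(1-3)] y by (rule bounded_op_mem)
  have "(\<Oplus>\<^bsub>H\<^esub>i\<in>I. f i) \<in> carrier H" using f by (intro H.finsum_closed) auto
  then have "cinner K (T (\<Oplus>\<^bsub>H\<^esub>i\<in>I. f i)) y = cinner H (\<Oplus>\<^bsub>H\<^esub>i\<in>I. f i) (adj H K T y)"
    using y by (simp add: cinner_adj[OF assms(1-3)])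
  also have "\<dots> = (\<Sum>i\<in>I. cinner H (f i) (adj H K T y))"
    using assms(4) f z by (rule H.cinner_finsum_left)
  also have "\<dots> = (\<Sum>i\<in>I. cinner K (T (f i)) y)"
    using f y by (intro sum.cong) (auto simp: cinner_adj[OF assms(1-3)])
  finally show ?thesis .
qed

lemma ex_inverse_if_bounded_below:
  assumes G: "G \<in> bounded_op H K" and HK: "chilbert H" "chilbert K"
    and c: "0 < c" "\<And>x. x \<in> carrier H \<Longrightarrow> c * cnorm H x \<le> cnorm K (G x)"
    and dense: "\<And>y. \<lbrakk>y \<in> carrier K; \<And>h. h \<in> carrier H \<Longrightarrow> cinner K (G h) y = 0\<rbrakk> \<Longrightarrow> y = \<zero>\<^bsub>K\<^esub>"
  shows "\<exists>S\<in>bounded_op K H. (\<forall>x\<in>carrier H. S (G x) = x) \<and> (\<forall>y\<in>carrier K. G (S y) = y)"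
proof -
  interpret H: chilbert H by fact
  interpret K: chilbert K by fact
  note [simp] = bounded_op_mem[OF G]
  have inj: "x = y" if "x \<in> carrier H" "y \<in> carrier H" "G x = G y" for x y
  proof -
    have "G (x \<ominus>\<^bsub>H\<^esub> y) = \<zero>\<^bsub>K\<^esub>"
      using that by (intro K.vec_eqI) (auto simp: bounded_op_diff[OF G HK] K.cinner_simps)
    then have "c * cnorm H (x \<ominus>\<^bsub>H\<^esub> y) \<le> 0"
      using c(2)[of "x \<ominus>\<^bsub>H\<^esub> y"] that by simp
    moreover have "0 \<le> cnorm H (x \<ominus>\<^bsub>H\<^esub> y)" using that by simp
    ultimately have "cnorm H (x \<ominus>\<^bsub>H\<^esub> y) = 0"
      using c(1) by (simp add: mult_le_0_iff)
    then show ?thesis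
      using that H.eq_if_diff_eq_zero[of x y] H.cnorm_eq_0[of "x \<ominus>\<^bsub>H\<^esub> y"] by simp
  qed
  have "\<exists>x\<in>carrier H. G x = y" if "y \<in> carrier K" for y
    by (rule surj_if_bounded_below[OF G HK c dense that])
  then obtain S where S [simp]: "\<And>y. y \<in> carrier K \<Longrightarrow> S y \<in> carrier H"
    "\<And>y. y \<in> carrier K \<Longrightarrow> G (S y) = y" by metis
  have "S \<in> bounded_op K H"
  proof (rule bounded_opI[where c = "1 / c"])
    fix y assume y: "y \<in> carrier K"
    show "cnorm H (S y) \<le> 1 / c * cnorm K y"
      using c(1) c(2)[of "S y"] y by (simp add: field_simps)
  \<comment> \<open>The two sides of each linearity law for \<open>S\<close> have the same image
    under the injective \<open>G\<close>.\<close>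
  qed (auto intro!: inj simp: bounded_op_add[OF G] bounded_op_smult[OF G])
  moreover have "S (G x) = x" if "x \<in> carrier H" for x
    using that by (intro inj) auto
  ultimately show ?thesis
    using S(2) by (intro bexI[of _ S]) simp_all
qed

section \<open>The spectral radius estimate\<close>

text \<open>The matrix \<open>lam\<close> is upper triangular while the block operator is not, so
  the terms can be compared only after symmetrisation in the two indices.\<close>

lemma double_sum_le_if_pairwise_le:
  fixes f g :: "'i \<Rightarrow> 'i \<Rightarrow> real"
  assumes "\<And>i j. \<lbrakk>i \<in> I; j \<in> I\<rbrakk> \<Longrightarrow> f i j + f j i \<le> g i j + g j i"
  shows "(\<Sum>i\<in>I. \<Sum>j\<in>I. f i j) \<le> (\<Sum>i\<in>I. \<Sum>j\<in>I. g i j)"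
proof -
  have "(\<Sum>i\<in>I. \<Sum>j\<in>I. f i j + f j i) \<le> (\<Sum>i\<in>I. \<Sum>j\<in>I. g i j + g j i)"
    by (intro sum_mono assms)
  moreover have "(\<Sum>i\<in>I. \<Sum>j\<in>I. h i j + h j i) = 2 * (\<Sum>i\<in>I. \<Sum>j\<in>I. h i j)" for h :: "'i \<Rightarrow> 'i \<Rightarrow> real"
    using sum.swap[of h I I] by (simp add: sum.distrib)
  ultimately show ?thesis by simp
qed

context
  notes One_nat_def [simp del]
  fixes n :: nat and H :: "nat \<Rightarrow> 'a cinner_space" and A B :: "nat \<Rightarrow> 'a \<Rightarrow> 'a"
  assumes n: "1 \<le> n"
    and H: "\<And>i. i \<in> {1..n} \<Longrightarrow> chilbert (H i)"
    and A: "\<And>i. i \<in> {1..n} \<Longrightarrow> A i \<in> bounded_op (H i) (H 1)"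
    and B: "\<And>i. i \<in> {1..n} \<Longrightarrow> B i \<in> bounded_op (H 1) (H i)"
begin

lemma H1: "chilbert (H 1)"
  using n by (intro H) auto

interpretation H1: chilbert "H 1" by (rule H1)

lemma BA: "\<lbrakk>i \<in> {1..n}; j \<in> {1..n}\<rbrakk> \<Longrightarrow> B i \<circ> A j \<in> bounded_op (H j) (H i)"
  by (intro bounded_op_comp[OF A B] H H1)

text \<open>Beyond \<open>off_diagonal_bound\<close>, the adjoints of the products must be
  identified with the products of adjoints used in \<open>lam\<close>. They are compared on the
  carriers only, which suffices because \<open>op_abs\<close> depends on nothing else.\<close>

lemma off_diagonal_lam:
  assumes ij: "i \<in> {1..n}" "j \<in> {1..n}" "i < j" and x: "x \<in> carrier (H j)" and y: "y \<in> carrier (H i)"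
  shows "cmod (cinner (H i) (B i (A j x)) y) + cmod (cinner (H j) (B j (A i y)) x)
    \<le> lam H A B i j * cnorm (H j) x * cnorm (H i) y"
proof -
  let ?As = "\<lambda>k. adj (H k) (H 1) (A k)" and ?Bs = "\<lambda>k. adj (H 1) (H k) (B k)"
  have adj_BA: "adj (H l) (H k) (B k \<circ> A l) z = (?As l \<circ> ?Bs k) z"
    if "k \<in> {1..n}" "l \<in> {1..n}" "z \<in> carrier (H k)" for k l z
    using that by (simp add: adj_comp[OF A B H H1 H])
  have Q: "op_abs (H j) (H i) (adj (H i) (H j) (B j \<circ> A i)) = op_abs (H j) (H i) (?As i \<circ> ?Bs j)"
    by (rule op_abs_cong) (rule adj_BA[OF ij(2,1)])
  have R: "op_abs (H i) (H j) (adj (H j) (H i) (B i \<circ> A j)) = op_abs (H i) (H j) (?As j \<circ> ?Bs i)"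
    by (rule op_abs_cong) (rule adj_BA[OF ij(1,2)])
  have lam: "lam H A B i j = sqrt
     (numerical_radius (H j) (op_add (H j) (op_abs (H j) (H i) (B i \<circ> A j))
         (op_scale (H j) \<i> (op_abs (H j) (H i) (?As i \<circ> ?Bs j)))) *
      numerical_radius (H i) (op_add (H i) (op_abs (H i) (H j) (?As j \<circ> ?Bs i))
         (op_scale (H i) \<i> (op_abs (H i) (H j) (B j \<circ> A i)))) +
      1 / 2 * op_norm (H j) (H j) (op_add (H j)
         (op_abs (H j) (H i) (B i \<circ> A j) \<circ> op_abs (H j) (H i) (B i \<circ> A j))
         (op_abs (H j) (H i) (?As i \<circ> ?Bs j) \<circ> op_abs (H j) (H i) (?As i \<circ> ?Bs j))) +
      numerical_radius (H j) ((B j \<circ> A i) \<circ> (B i \<circ> A j)))" (is "_ = sqrt ?L")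
    using ij(3) by (simp add: lam_def Let_def comp_assoc)
  have "(cmod (cinner (H i) (B i (A j x)) y) + cmod (cinner (H j) (B j (A i y)) x))\<^sup>2
      \<le> ?L * ((cnorm (H j) x)\<^sup>2 * (cnorm (H i) y)\<^sup>2)"
    using off_diagonal_bound[OF BA[OF ij(1,2)] BA[OF ij(2,1)] H[OF ij(2)] H[OF ij(1)] x y]
    unfolding Q R by simp
  then have "cmod (cinner (H i) (B i (A j x)) y) + cmod (cinner (H j) (B j (A i y)) x)
      \<le> sqrt (?L * ((cnorm (H j) x)\<^sup>2 * (cnorm (H i) y)\<^sup>2))"
    by (rule real_le_rsqrt)
  also have "\<dots> = lam H A B i j * cnorm (H j) x * cnorm (H i) y"
    unfolding lam real_sqrt_mult
    using chilbert.cnorm_nonneg[OF H[OF ij(2)] x] chilbert.cnorm_nonneg[OF H[OF ij(1)] y] by simp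
  finally show ?thesis .
qed

text \<open>Matrix indices start at \<open>0\<close> and the spaces are numbered from
  \<open>1\<close>, hence the shifts by \<open>Suc\<close>.\<close>

definition "lam_radius = mat_numerical_radius n (mat n n (\<lambda>(i, j). complex_of_real (lam H A B (Suc i) (Suc j))))"

lemma lam_radius_nonneg: "0 \<le> lam_radius"
  unfolding lam_radius_def by (rule mat_numerical_radius_nonneg) simp

text \<open>The family \<open>z\<close> plays the role of a vector of the direct sum: the left side
  is the form of the block operator with entries \<open>B i \<circ> A j\<close> at \<open>z\<close>,
  and the sum on the right is the squared norm of \<open>z\<close>.\<close>

lemma block_numerical_radius:
  assumes z: "\<And>i. i \<in> {1..n} \<Longrightarrow> z i \<in> carrier (H i)"
  shows "cmod (\<Sum>i\<in>{1..n}. \<Sum>j\<in>{1..n}. cinner (H i) (B i (A j (z j))) (z i))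
    \<le> lam_radius * (\<Sum>i\<in>{1..n}. (cnorm (H i) (z i))\<^sup>2)"
proof -
  let ?c = "\<lambda>i j. cmod (cinner (H i) (B i (A j (z j))) (z i))"
  let ?u = "\<lambda>i. cnorm (H i) (z i)"
  let ?L = "\<lambda>i j. lam H A B i j * ?u j * ?u i"
  have less: "?c i j + ?c j i \<le> ?L i j + ?L j i" if "i \<in> {1..n}" "j \<in> {1..n}" "i < j" for i j
    \<comment> \<open>The whole bound sits in the entry \<open>(i, j)\<close>, as
      \<open>lam H A B j i\<close> is \<open>0\<close> for \<open>i < j\<close>.\<close>
    using off_diagonal_lam[OF that z z] that by (simp add: lam_def)
  have pair: "?c i j + ?c j i \<le> ?L i j + ?L j i" if ij: "i \<in> {1..n}" "j \<in> {1..n}" for i j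
  proof -
    consider "i < j" | "j < i" | "i = j" by linarith
    then show ?thesis
    proof cases
      case 3
      \<comment> \<open>On the diagonal the required inequality is twice this one.\<close>
      have "?c i i \<le> numerical_radius (H i) (B i \<circ> A i) * (?u i)\<^sup>2"
        using chilbert.cmod_le_numerical_radius[OF H[OF ij(1)] BA[OF ij(1) ij(1)] z[OF ij(1)]] 3 by simp
      then show ?thesis using 3 by (simp add: lam_def power2_eq_square mult_ac)
    qed (use less[of i j] less[of j i] ij in auto)
  qed
  have "cmod (\<Sum>i\<in>{1..n}. \<Sum>j\<in>{1..n}. cinner (H i) (B i (A j (z j))) (z i)) \<le> (\<Sum>i\<in>{1..n}. \<Sum>j\<in>{1..n}. ?c i j)"
    by (intro order_trans[OF norm_sum] sum_mono norm_sum)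
  also have "\<dots> \<le> (\<Sum>i\<in>{1..n}. \<Sum>j\<in>{1..n}. ?L i j)"
    by (intro double_sum_le_if_pairwise_le pair)
  also have "\<dots> = (\<Sum>i<n. \<Sum>j<n. lam H A B (Suc i) (Suc j) * ?u (Suc j) * ?u (Suc i))"
    by (simp add: sum.atLeast1_atMost_eq One_nat_def)
  also have "\<dots> \<le> lam_radius * (\<Sum>i<n. (?u (Suc i))\<^sup>2)"
    unfolding lam_radius_def by (rule real_quadratic_form_le_mat_numerical_radius)
  also have "\<dots> = lam_radius * (\<Sum>i\<in>{1..n}. (?u i)\<^sup>2)"
    by (simp add: sum.atLeast1_atMost_eq One_nat_def)
  finally show ?thesis .
qed

section \<open>The sum of the products and the inverse of its shifts\<close>

definition "AB_sum = (\<lambda>x. \<Oplus>\<^bsub>H 1\<^esub>i\<in>{1..n}. A i (B i x))"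

lemma AB_mem: "\<lbrakk>i \<in> {1..n}; x \<in> carrier (H 1)\<rbrakk> \<Longrightarrow> A i (B i x) \<in> carrier (H 1)"
  by (rule bounded_op_mem[OF A bounded_op_mem[OF B]])

lemma AB_sum_bounded: "AB_sum \<in> bounded_op (H 1) (H 1)"
  unfolding AB_sum_def
proof (intro bounded_op_finsum H1)
  fix i assume "i \<in> {1..n}"
  then show "(\<lambda>x. A i (B i x)) \<in> bounded_op (H 1) (H 1)"
    using bounded_op_comp[OF B A H1 H] by (simp add: comp_def)
qed auto

lemma cinner_AB_sum:
  assumes x: "x \<in> carrier (H 1)" and y: "y \<in> carrier (H 1)"
  shows "cinner (H 1) (AB_sum x) y = (\<Sum>i\<in>{1..n}. cinner (H 1) (A i (B i x)) y)"
  unfolding AB_sum_def using AB_mem x y by (intro H1.cinner_finsum_left) auto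

definition "AB_shift l = (\<lambda>x. AB_sum x \<ominus>\<^bsub>H 1\<^esub> l \<odot>\<^bsub>H 1\<^esub> x)"

lemma AB_shift_bounded: "AB_shift l \<in> bounded_op (H 1) (H 1)"
proof (rule bounded_op_cong[OF _ H1])
  show "(\<lambda>x. AB_sum x \<oplus>\<^bsub>H 1\<^esub> (- l) \<odot>\<^bsub>H 1\<^esub> x) \<in> bounded_op (H 1) (H 1)"
    by (intro bounded_op_op_add bounded_op_op_scale H1.bounded_op_id AB_sum_bounded H1)
  show "AB_shift l x = AB_sum x \<oplus>\<^bsub>H 1\<^esub> (- l) \<odot>\<^bsub>H 1\<^esub> x" if "x \<in> carrier (H 1)" for x
    using that bounded_op_mem[OF AB_sum_bounded that] unfolding AB_shift_def
    by (intro H1.vec_eqI) (auto simp: H1.cinner_simps)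
qed

lemma ex_common_bound:
  obtains c where "0 \<le> c" "\<And>i x. \<lbrakk>i \<in> {1..n}; x \<in> carrier (H 1)\<rbrakk> \<Longrightarrow> cnorm (H i) (B i x) \<le> c * cnorm (H 1) x"
    "\<And>i x. \<lbrakk>i \<in> {1..n}; x \<in> carrier (H i)\<rbrakk> \<Longrightarrow> cnorm (H 1) (A i x) \<le> c * cnorm (H i) x"
proof -
  have "\<exists>b\<ge>0. \<forall>x\<in>carrier (H 1). cnorm (H i) (B i x) \<le> b * cnorm (H 1) x" if "i \<in> {1..n}" for i
    using bounded_op_bound[OF B[OF that] H1] by metis
  then obtain b where b: "\<And>i. i \<in> {1..n} \<Longrightarrow> 0 \<le> b i"
    "\<And>i x. \<lbrakk>i \<in> {1..n}; x \<in> carrier (H 1)\<rbrakk> \<Longrightarrow> cnorm (H i) (B i x) \<le> b i * cnorm (H 1) x" by metis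
  have "\<exists>a\<ge>0. \<forall>x\<in>carrier (H i). cnorm (H 1) (A i x) \<le> a * cnorm (H i) x" if "i \<in> {1..n}" for i
    using bounded_op_bound[OF A[OF that] H[OF that]] by metis
  then obtain a where a: "\<And>i. i \<in> {1..n} \<Longrightarrow> 0 \<le> a i"
    "\<And>i x. \<lbrakk>i \<in> {1..n}; x \<in> carrier (H i)\<rbrakk> \<Longrightarrow> cnorm (H 1) (A i x) \<le> a i * cnorm (H i) x" by metis
  define c where "c = (\<Sum>i\<in>{1..n}. a i + b i)"
  have ab: "a i + b i \<le> c" if "i \<in> {1..n}" for i
    unfolding c_def using that a(1) b(1) by (intro member_le_sum) auto
  show thesis
  proof (rule that[of c])
    show "0 \<le> c" unfolding c_def using a(1) b(1) by (intro sum_nonneg) auto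
    fix i x assume i: "i \<in> {1..n}"
    show "cnorm (H i) (B i x) \<le> c * cnorm (H 1) x" if x: "x \<in> carrier (H 1)"
      using b(2)[OF i x] mult_right_mono[of "b i" c "cnorm (H 1) x"] ab[OF i] a(1)[OF i] x by simp
    show "cnorm (H 1) (A i x) \<le> c * cnorm (H i) x" if x: "x \<in> carrier (H i)"
      using a(2)[OF i x] mult_right_mono[of "a i" c "cnorm (H i) x"] ab[OF i] b(1)[OF i]
        chilbert.cnorm_nonneg[OF H[OF i] x] by simp
  qed
qed

text \<open>\<open>AB_shift l\<close> is invertible for \<open>|l| > lam_radius\<close> because \<open>B (AB - l) = (BA - l) B\<close> and \<open>BA - l\<close>, on the direct
  sum of the spaces, has a numerical range that stays away from \<open>0\<close>.\<close>

lemma AB_shift_bounded_below: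
  assumes l: "lam_radius < cmod l"
  obtains c where "0 < c" "\<And>x. x \<in> carrier (H 1) \<Longrightarrow> c * cnorm (H 1) x \<le> cnorm (H 1) (AB_shift l x)"
proof -
  define d where "d = cmod l - lam_radius"
  have d: "0 < d" using l by (simp add: d_def)
  obtain c where c: "0 \<le> c"
    "\<And>i x. \<lbrakk>i \<in> {1..n}; x \<in> carrier (H 1)\<rbrakk> \<Longrightarrow> cnorm (H i) (B i x) \<le> c * cnorm (H 1) x"
    "\<And>i x. \<lbrakk>i \<in> {1..n}; x \<in> carrier (H i)\<rbrakk> \<Longrightarrow> cnorm (H 1) (A i x) \<le> c * cnorm (H i) x"
    by (rule ex_common_bound) blast
  have est: "cmod l * cnorm (H 1) x \<le> (c * (real n * c / d) + 1) * cnorm (H 1) (AB_shift l x)"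
    if x [simp]: "x \<in> carrier (H 1)" for x
  proof -
    define g where "g = cnorm (H 1) (AB_shift l x)"
    define u where "u i = cnorm (H i) (B i x)" for i
    define s where "s = (\<Sum>i\<in>{1..n}. u i)"
    define q where "q = (\<Sum>i\<in>{1..n}. (u i)\<^sup>2)"
    note Bx [simp] = bounded_op_mem[OF B x]
    have Gx [simp]: "AB_shift l x \<in> carrier (H 1)" and Tx [simp]: "AB_sum x \<in> carrier (H 1)"
      using bounded_op_mem[OF AB_shift_bounded x] bounded_op_mem[OF AB_sum_bounded x] by auto
    have g: "0 \<le> g" by (simp add: g_def)
    have u: "0 \<le> u i" if "i \<in> {1..n}" for i
      using chilbert.cnorm_nonneg[OF H[OF that] Bx[OF that]] by (simp add: u_def)
    have s: "0 \<le> s" unfolding s_def using u by (intro sum_nonneg) auto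
    have BG: "cinner (H i) (B i (AB_shift l x)) (B i x) =
        (\<Sum>j\<in>{1..n}. cinner (H i) (B i (A j (B j x))) (B i x)) - l * of_real ((u i)\<^sup>2)"
      if i: "i \<in> {1..n}" for i
    proof -
      interpret Hi: chilbert "H i" by (rule H[OF i])
      have "B i (AB_shift l x) = B i (AB_sum x) \<ominus>\<^bsub>H i\<^esub> l \<odot>\<^bsub>H i\<^esub> B i x"
        unfolding AB_shift_def by (simp add: bounded_op_diff[OF B[OF i] H1 H[OF i]] bounded_op_smult[OF B[OF i]])
      moreover have "cinner (H i) (B i (AB_sum x)) (B i x) = (\<Sum>j\<in>{1..n}. cinner (H i) (B i (A j (B j x))) (B i x))"
        unfolding AB_sum_def using AB_mem i by (intro cinner_bounded_op_finsum[OF B[OF i] H1 H[OF i]]) auto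
      ultimately show ?thesis
        using i Bx[OF i] bounded_op_mem[OF B[OF i] Tx]
        by (simp add: Hi.cinner_simps Hi.cinner_self u_def)
    qed
    \<comment> \<open>Applying the \<open>B i\<close> to \<open>AB_shift l x\<close> gives the block
      operator minus \<open>l\<close> at the family \<open>B i x\<close>. Its form there isolates
      \<open>l * q\<close>, and the gap \<open>d\<close> between \<open>cmod l\<close> and
      \<open>lam_radius\<close> absorbs the block part.\<close>
    have "cmod l * q = cmod (\<Sum>i\<in>{1..n}. l * of_real ((u i)\<^sup>2))"
      by (simp add: q_def norm_mult sum_nonneg flip: sum_distrib_left of_real_power of_real_sum)
    also have "\<dots> = cmod ((\<Sum>i\<in>{1..n}. \<Sum>j\<in>{1..n}. cinner (H i) (B i (A j (B j x))) (B i x)) -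
        (\<Sum>i\<in>{1..n}. cinner (H i) (B i (AB_shift l x)) (B i x)))"
      using BG by (simp add: sum_subtractf)
    also have "\<dots> \<le> lam_radius * q + (\<Sum>i\<in>{1..n}. c * g * u i)"
    proof (rule order_trans[OF norm_triangle_ineq4 add_mono])
      show "cmod (\<Sum>i\<in>{1..n}. \<Sum>j\<in>{1..n}. cinner (H i) (B i (A j (B j x))) (B i x)) \<le> lam_radius * q"
        unfolding q_def u_def by (rule block_numerical_radius) simp
      show "cmod (\<Sum>i\<in>{1..n}. cinner (H i) (B i (AB_shift l x)) (B i x)) \<le> (\<Sum>i\<in>{1..n}. c * g * u i)"
      proof (rule order_trans[OF norm_sum sum_mono])
        fix i assume i: "i \<in> {1..n}"
        have "cmod (cinner (H i) (B i (AB_shift l x)) (B i x)) \<le> cnorm (H i) (B i (AB_shift l x)) * u i"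
          unfolding u_def using i by (intro chilbert.Cauchy_Schwarz H bounded_op_mem[OF B]) auto
        also have "\<dots> \<le> c * g * u i"
          unfolding g_def using c(2)[OF i Gx] u[OF i] by (intro mult_right_mono) auto
        finally show "cmod (cinner (H i) (B i (AB_shift l x)) (B i x)) \<le> c * g * u i" .
      qed
    qed
    finally have "d * q \<le> c * g * s"
      by (simp add: d_def s_def sum_distrib_left left_diff_distrib)
    moreover have "s\<^sup>2 \<le> q * real n"
      \<comment> \<open>Cauchy-Schwarz passes from the sum of squares to the plain sum of norms, at
        the price of the factor \<open>n\<close>.\<close>
      unfolding s_def q_def using sum_squared_le_sum_of_squares[of u "{1..n}"] by simp
    then have "d * s\<^sup>2 \<le> d * (q * real n)"
      using d by (intro mult_left_mono) auto
    moreover have "real n * (d * q) \<le> real n * (c * g * s)"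
      using \<open>d * q \<le> c * g * s\<close> by (rule mult_left_mono) simp
    ultimately have *: "(d * s) * s \<le> (real n * c * g) * s"
      by (simp add: power2_eq_square mult_ac)
    have "d * s \<le> real n * c * g"
    proof (cases "s = 0")
      case True
      then show ?thesis using c(1) g by simp
    next
      case False
      then show ?thesis using s mult_right_le_imp_le[OF *] by simp
    qed
    then have sg: "s \<le> real n * c / d * g"
      using d by (simp add: field_simps)
    \<comment> \<open>So far only the vectors \<open>B i x\<close> are controlled, which says
      nothing about common kernel vectors of the \<open>B i\<close>. Solving for \<open>l x\<close>
      recovers \<open>x\<close> itself from the \<open>B i x\<close> and
      \<open>AB_shift l x\<close>.\<close>
    have "l \<odot>\<^bsub>H 1\<^esub> x = AB_sum x \<ominus>\<^bsub>H 1\<^esub> AB_shift l x"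
      unfolding AB_shift_def by (intro H1.vec_eqI) (auto simp: H1.cinner_simps)
    then have "cmod l * cnorm (H 1) x = cnorm (H 1) (AB_sum x \<ominus>\<^bsub>H 1\<^esub> AB_shift l x)"
      using H1.cnorm_smult[OF x, of l] by simp
    also have "\<dots> \<le> cnorm (H 1) (AB_sum x) + g"
      unfolding g_def by (rule H1.cnorm_diff_triangle) auto
    also have "cnorm (H 1) (AB_sum x) \<le> (\<Sum>i\<in>{1..n}. cnorm (H 1) (A i (B i x)))"
      unfolding AB_sum_def using AB_mem by (intro H1.cnorm_finsum) auto
    also have "\<dots> \<le> (\<Sum>i\<in>{1..n}. c * u i)"
      unfolding u_def by (intro sum_mono c(3)) auto
    also have "\<dots> = c * s" by (simp add: s_def sum_distrib_left)
    also have "\<dots> \<le> c * (real n * c / d * g)"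
      using sg c(1) by (rule mult_left_mono)
    finally show ?thesis by (simp add: g_def algebra_simps)
  qed
  let ?k = "c * (real n * c / d) + 1"
  have k: "0 < ?k" using c(1) d by (intro add_nonneg_pos) auto
  show thesis
  proof (rule that[of "cmod l / ?k"])
    show "0 < cmod l / ?k" using k l lam_radius_nonneg by (intro divide_pos_pos) auto
    fix x assume "x \<in> carrier (H 1)"
    from est[OF this] show "cmod l / ?k * cnorm (H 1) x \<le> cnorm (H 1) (AB_shift l x)"
      using k by (simp add: pos_divide_le_eq mult_ac)
  qed
qed

text \<open>The dual argument, with the adjoints of the \<open>A i\<close> at \<open>y\<close> in
  place of the \<open>B i x\<close>. Orthogonality tested at \<open>h = A i (z i)\<close> and summed
  over \<open>i\<close> shows that the block form at \<open>z\<close> equals \<open>l\<close> times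
  the squared norm of \<open>z\<close>, so \<open>z\<close> vanishes; testing at
  \<open>h = y\<close> then gives \<open>y = 0\<close>.\<close>

lemma AB_shift_dense:
  assumes l: "lam_radius < cmod l" and y [simp]: "y \<in> carrier (H 1)"
    and orth: "\<And>h. h \<in> carrier (H 1) \<Longrightarrow> cinner (H 1) (AB_shift l h) y = 0"
  shows "y = \<zero>\<^bsub>H 1\<^esub>"
proof -
  define z where "z i = adj (H i) (H 1) (A i) y" for i
  have z: "z i \<in> carrier (H i)" if "i \<in> {1..n}" for i
    unfolding z_def by (rule bounded_op_mem[OF adj_bounded_op[OF A H H1] y]) (use that in auto)
  have cinner_z: "cinner (H i) w (z i) = cinner (H 1) (A i w) y"
    if "i \<in> {1..n}" "w \<in> carrier (H i)" for i w
    unfolding z_def using that by (intro cinner_adj[OF A H H1]) auto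
  have eq: "(\<Sum>j\<in>{1..n}. cinner (H j) (B j h) (z j)) = l * cinner (H 1) h y"
    if h [simp]: "h \<in> carrier (H 1)" for h
  proof -
    have "cinner (H 1) (AB_sum h) y = l * cinner (H 1) h y"
      using orth[OF h] bounded_op_mem[OF AB_sum_bounded h] by (simp add: AB_shift_def H1.cinner_simps)
    moreover have "cinner (H 1) (AB_sum h) y = (\<Sum>j\<in>{1..n}. cinner (H j) (B j h) (z j))"
      unfolding cinner_AB_sum[OF h y] by (intro sum.cong refl cinner_z[symmetric] bounded_op_mem[OF B]) auto
    ultimately show ?thesis by simp
  qed
  define q where "q = (\<Sum>i\<in>{1..n}. (cnorm (H i) (z i))\<^sup>2)"
  have "(\<Sum>j\<in>{1..n}. cinner (H j) (B j (A i (z i))) (z j)) = l * of_real ((cnorm (H i) (z i))\<^sup>2)"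
    if i: "i \<in> {1..n}" for i
    using eq[of "A i (z i)"] bounded_op_mem[OF A[OF i] z[OF i]] cinner_z[OF i z[OF i]]
      chilbert.cinner_self[OF H[OF i] z[OF i]] by simp
  then have "(\<Sum>i\<in>{1..n}. \<Sum>j\<in>{1..n}. cinner (H j) (B j (A i (z i))) (z j)) = l * of_real q"
    by (simp add: q_def sum_distrib_left)
  then have "(\<Sum>j\<in>{1..n}. \<Sum>i\<in>{1..n}. cinner (H j) (B j (A i (z i))) (z j)) = l * of_real q"
    by (subst sum.swap)
  then have "cmod (l * of_real q) \<le> lam_radius * q"
    using block_numerical_radius[of z] z by (simp add: q_def)
  moreover have q: "0 \<le> q" unfolding q_def by (intro sum_nonneg) auto
  ultimately have "(cmod l - lam_radius) * q \<le> 0"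
    by (simp add: norm_mult left_diff_distrib)
  then have "q = 0"
    using q l by (simp add: mult_le_0_iff)
  then have "cnorm (H i) (z i) = 0" if "i \<in> {1..n}" for i
    using that unfolding q_def by (subst (asm) sum_nonneg_eq_0_iff) auto
  then have z0: "z i = \<zero>\<^bsub>H i\<^esub>" if "i \<in> {1..n}" for i
    using chilbert.cnorm_eq_0[OF H z] that by blast
  have "cinner (H j) (B j y) (z j) = 0" if j: "j \<in> {1..n}" for j
    unfolding z0[OF j] by (intro chilbert.cinner_zero_right H bounded_op_mem[OF B] j y)
  then have "l * cinner (H 1) y y = 0"
    using eq[OF y] by simp
  moreover have "l \<noteq> 0" using l lam_radius_nonneg by auto
  ultimately show ?thesis
    using H1.cinner_definite[OF y] by simp
qed

lemma op_spectrum_bound: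
  assumes "l \<in> op_spectrum (H 1) AB_sum"
  shows "cmod l \<le> lam_radius"
proof (rule ccontr)
  assume "\<not> cmod l \<le> lam_radius"
  then have l: "lam_radius < cmod l" by simp
  obtain c where c: "0 < c" "\<And>x. x \<in> carrier (H 1) \<Longrightarrow> c * cnorm (H 1) x \<le> cnorm (H 1) (AB_shift l x)"
    using AB_shift_bounded_below[OF l] by blast
  have "\<exists>S\<in>bounded_op (H 1) (H 1). (\<forall>x\<in>carrier (H 1). S (AB_shift l x) = x) \<and> (\<forall>y\<in>carrier (H 1). AB_shift l (S y) = y)"
    by (rule ex_inverse_if_bounded_below[OF AB_shift_bounded H1 H1 c AB_shift_dense[OF l]])
  then show False
    using assms unfolding op_spectrum_def AB_shift_def by blast
qed

lemma op_spectral_radius_le: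
  "op_spectral_radius (H 1) (\<lambda>x. \<Oplus>\<^bsub>H 1\<^esub>i\<in>{1..n}. A i (B i x))
    \<le> mat_numerical_radius n (mat n n (\<lambda>(i, j). complex_of_real (lam H A B (Suc i) (Suc j))))"
proof -
  have "op_spectral_radius (H 1) AB_sum \<le> lam_radius"
    unfolding op_spectral_radius_def
    \<comment> \<open>The inserted \<open>0\<close> makes the set nonempty even if the spectrum is
      empty, and nonnegativity of \<open>lam_radius\<close> covers that element.\<close>
    using op_spectrum_bound lam_radius_nonneg by (intro cSup_least) auto
  then show ?thesis
    unfolding AB_sum_def lam_radius_def .
qed

end

theorem theorem3p4:
  fixes n :: nat
    and H :: "nat \<Rightarrow> 'a cinner_space"
    and A B :: "nat \<Rightarrow> 'a \<Rightarrow> 'a"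
  assumes "1 \<le> n"
    and "\<And>i. i \<in> {1..n} \<Longrightarrow> chilbert (H i)"
    and "\<And>i. i \<in> {1..n} \<Longrightarrow> A i \<in> bounded_op (H i) (H 1)"
    and "\<And>i. i \<in> {1..n} \<Longrightarrow> B i \<in> bounded_op (H 1) (H i)"
  shows "op_spectral_radius (H 1) (\<lambda>x. \<Oplus>\<^bsub>H 1\<^esub>i\<in>{1..n}. A i (B i x))
    \<le> mat_numerical_radius n
        (mat n n (\<lambda>(i, j). complex_of_real (lam H A B (Suc i) (Suc j))))"
  by (rule op_spectral_radius_le) (rule assms; assumption)+

end
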